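(* Let $V^{[*]}$ be a dg vertex operator algebra and let $M^{[*]}$ be a weak dg $V^{[*]}$-module. The space $A(M^{[*]})=M^{[*]}/O(M^{[*]})$ with the operations $\ast_l$ and $\ast_r$ is an $A(V^{[*]})$-bimodule.
   Context: All vector spaces are over $\mathbb C$. A (cochain) complex $V^{[*]}=\bigoplus_{p\in\mathbb Z}V^{[p]}$ has a differential $d_V$ of degree $+1$ with $d_V^2=0$; $|v|=p$ for $v\in V^{[p]}$ (dg homogeneous elements). $\operatorname{End}^{[*]}(V^{[*]})=\bigoplus_p\operatorname{End}^{[p]}(V^{[*]})$, where $\operatorname{End}^{[p]}$ is the space of linear maps of degree $p$. A dg vertex algebra $(V^{[*]},d_V,Y(\cdot,x),\mathbf 1)$ is a complex with a linear map $v\mapsto Y(v,x)=\sum_{n\in\mathbb Z}v_nx^{-n-1}\in\operatorname{End}^{[*]}(V^{[*]})[[x,x^{-1}]]$ such that for $v\in V^{[p]}$ one has $v_n\in\operatorname{End}^{[p-2n-2]}(V^{[*]})$ and $(d_Vv)_n=d_V\circ v_n-(-1)^{p}v_n\circ d_V$, and a vector $\mathbf 1\in V^{[0]}$ with $d_V\mathbf 1=0$, such that: $u_nv=0$ for $n$ sufficiently large; $Y(\mathbf 1,x)=\operatorname{id}$; $Y(v,x)\mathbf 1\in V^{[*]}[[x]]$ with constant term $v$; and (Jacobi identity) for homogeneous $u,v$ and all $l,m,n\in\mathbb Z$, $$\sum_{i\ge0}(-1)^i\binom li\left(u_{m+l-i}v_{n+i}-(-1)^{l}(-1)^{|u||v|}v_{n+l-i}u_{m+i}\right)=\sum_{i\ge0}\binom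 mi(u_{l+i}v)_{m+n-i}.$$ A dg vertex operator algebra is a dg vertex algebra with $\omega\in V^{[4]}$, $d_V\omega=0$, such that, writing $Y(\omega,x)=\sum_nL(n)x^{-n-2}$: $[L(m),L(n)]=(m-n)L(m+n)+\frac1{12}(m^3-m)\delta_{m+n,0}c_V$ for some $c_V\in\mathbb C$; $L(0)$ is semisimple with $V^{[*]}=\bigoplus_{n\in\frac12\mathbb Z}V_n^{[*]}$, $V_n^{[*]}$ the eigenspace of eigenvalue (weight) $n$, $\omega\in V_2^{[*]}$, $\dim V_n^{[*]}<\infty$, $V_n^{[*]}=0$ for $n\ll0$; and $L(-1)v=v_{-2}\mathbf 1$. Write $\operatorname{wt}(u)=n$ for $u\in V_n^{[*]}$. A weak dg module over $V^{[*]}$ is a complex $(M^{[*]},d_M)$ with a linear map $v\mapsto Y_M(v,x)=\sum_nv_nx^{-n-1}\in\operatorname{End}^{[*]}(M^{[*]})[[x,x^{-1}]]$ such that for $v\in V^{[p]}$, $v_n\in\operatorname{End}^{[p-2n-2]}(M^{[*]})$ and $(d_Vv)_n=d_M\circ v_n-(-1)^pv_n\circ d_M$; $v_nm=0$ for $n$ sufficiently large; $Y_M(\mathbf 1,x)=\operatorname{id}$; and the displayed Jacobi identity holds for operators on $M^{[*]}$. Zhu algebra: for $u$ weight homogeneous (extended linearly in $u$), $u\ast v=\operatorname{Res}_x\left(Y(u,x)\frac{(1+x)^{\operatorname{wt}(u)}}{x}v\right)=\sum_{n\ge0}\binom{\operatorname{wt}(u)}{n}u_{n-1}v$ and $u\circ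 v=\operatorname{Res}_x\left(Y(u,x)\frac{(1+x)^{\operatorname{wt}(u)}}{x^2}v\right)$. $O(V^{[*]})$ is the span of all $u\circ v$; $A(V^{[*]})=V^{[*]}/O(V^{[*]})$ is an associative algebra under $\ast$ with unit the class of $\mathbf 1$. $O(M^{[*]})$ is the span of all $u\circ m=\operatorname{Res}_z\left(Y_M(u,z)\frac{(1+z)^{\operatorname{wt}(u)}}{z^2}m\right)$, $u\in V^{[*]}$ weight homogeneous, $m\in M^{[*]}$. For $u\in V^{[*]}$ homogeneous in both weight and degree and $m\in M^{[*]}$ dg homogeneous, $$u\ast_lm=\operatorname{Res}_z\left(Y_M(u,z)\frac{(1+z)^{\operatorname{wt}(u)}}{z}m\right),\qquad m\ast_ru=(-1)^{|u||m|}\operatorname{Res}_z\left(Y_M(u,z)\frac{(1+z)^{\operatorname{wt}(u)-1}}{z}m\right),$$ extended bilinearly; the operations in the claim are those induced on $A(V^{[*]})$ and $A(M^{[*]})$. Powers of $1+z$ are expanded in nonnegative powers of $z$. *)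

theory Defs
  imports Complex_Main "HOL-Algebra.Module" "HOL-Library.Groups_Big_Fun" "HOL-Library.Set_Algebras"
begin

section \<open>Direct sums and complexes\<close>

definition decomposition :: "'i set \<Rightarrow> ('i \<Rightarrow> 'v::ab_group_add set) \<Rightarrow> 'v \<Rightarrow> ('i \<Rightarrow> 'v) \<Rightarrow> bool" where
  "decomposition I W v f \<longleftrightarrow>
     finite {i. f i \<noteq> 0} \<and> (\<forall>i\<in>I. f i \<in> W i) \<and> (\<forall>i. i \<notin> I \<longrightarrow> f i = 0) \<and> v = Sum_any f"

definition direct_sum ::
  "(complex \<Rightarrow> 'v \<Rightarrow> 'v) \<Rightarrow> 'i set \<Rightarrow> ('i \<Rightarrow> 'v::ab_group_add set) \<Rightarrow> bool" where
  "direct_sum s I W \<longleftrightarrow>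
     (\<forall>i\<in>I. Modules.module.subspace s (W i)) \<and> (\<forall>v. \<exists>!f. decomposition I W v f)"

definition component :: "'i set \<Rightarrow> ('i \<Rightarrow> 'v::ab_group_add set) \<Rightarrow> 'v \<Rightarrow> 'i \<Rightarrow> 'v" where
  "component I W v = (THE f. decomposition I W v f)"

locale cochain_complex = Vector_Spaces.vector_space s
  for s :: "complex \<Rightarrow> 'v::ab_group_add \<Rightarrow> 'v" +
  fixes V :: "int \<Rightarrow> 'v set" and d :: "'v \<Rightarrow> 'v"
  assumes graded: "direct_sum s UNIV V"
    and d_linear: "Vector_Spaces.linear s s d"
    and d_degree: "v \<in> V p \<Longrightarrow> d v \<in> V (p + 1)"
    and d_square: "d (d v) = 0"

section \<open>Dg vertex (operator) algebras and weak dg modules\<close>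

text \<open>
  A field \<open>Y(v, x) = \<Sum>\<^sub>n v\<^sub>n x\<^sup>-\<^sup>n\<^sup>-\<^sup>1\<close> is given by its modes: \<open>Y v n\<close> is the operator \<open>v\<^sub>n\<close>.
  The following locale collects the axioms shared by dg vertex algebras (where the complex
  acted on is the algebra itself) and their weak dg modules. \<open>YV\<close> denotes the modes on the
  algebra, \<open>Y\<close> those on the complex acted on. By truncation (of \<open>Y\<close> and, on the right-hand side
  of the Jacobi identity, of \<open>YV\<close>) all sums below have finite support, as \<open>Sum_any\<close> requires.
\<close>

locale dg_action =
  V: cochain_complex sV V dV + M: cochain_complex sM M dM
  for sV :: "complex \<Rightarrow> 'v::ab_group_add \<Rightarrow> 'v" and V dV
    and sM :: "complex \<Rightarrow> 'm::ab_group_add \<Rightarrow> 'm" and M dM +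
  fixes YV :: "'v \<Rightarrow> int \<Rightarrow> 'v \<Rightarrow> 'v" and vac :: 'v and Y :: "'v \<Rightarrow> int \<Rightarrow> 'm \<Rightarrow> 'm"
  assumes Y_linear: "Vector_Spaces.linear sV sM (\<lambda>v. Y v n w)"
    and mode_linear: "Vector_Spaces.linear sM sM (Y v n)"
    and mode_degree: "v \<in> V p \<Longrightarrow> w \<in> M q \<Longrightarrow> Y v n w \<in> M (q + (p - 2 * n - 2))"
    and mode_differential:
      "v \<in> V p \<Longrightarrow> Y (dV v) n w = dM (Y v n w) - sM ((-1) powi p) (Y v n (dM w))"
    and truncation: "\<exists>N. \<forall>n\<ge>N. Y v n w = 0"
    and vacuum: "Y vac n w = (if n = -1 then w else 0)"
    and Jacobi: "u \<in> V p \<Longrightarrow> v \<in> V q \<Longrightarrow>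
      Sum_any (\<lambda>i::nat. sM ((-1) ^ i * (of_int l gchoose i))
          (Y u (m + l - int i) (Y v (n + int i) w)
            - sM ((-1) powi l * (-1) powi (p * q)) (Y v (n + l - int i) (Y u (m + int i) w))))
      = Sum_any (\<lambda>i::nat. sM (of_int m gchoose i) (Y (YV u (l + int i) v) (m + n - int i) w))"

locale dg_vertex_algebra = dg_action s V d s V d Y vac Y
  for s :: "complex \<Rightarrow> 'v::ab_group_add \<Rightarrow> 'v" and V d Y vac +
  assumes vac_degree: "vac \<in> V 0"
    and d_vac: "d vac = 0"
    and creation: "n \<ge> 0 \<Longrightarrow> Y v n vac = 0"
    and creation_constant: "Y v (-1) vac = v"

definition half_integers :: "complex set" where
  "half_integers = range (\<lambda>k::int. of_int k / 2)"

text \<open>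
  With \<open>Y(\<omega>, x) = \<Sum>\<^sub>n L(n) x\<^sup>-\<^sup>n\<^sup>-\<^sup>2\<close>, the operator \<open>L(n)\<close> is the mode \<open>\<omega>\<^sub>n\<^sub>+\<^sub>1\<close>.
\<close>

definition weight_space ::
  "(complex \<Rightarrow> 'v \<Rightarrow> 'v) \<Rightarrow> ('v \<Rightarrow> int \<Rightarrow> 'v \<Rightarrow> 'v) \<Rightarrow> 'v \<Rightarrow> complex \<Rightarrow> 'v set" where
  "weight_space s Y \<omega> a = {v. Y \<omega> 1 v = s a v}"

locale dg_vertex_operator_algebra = dg_vertex_algebra s V d Y vac
  for s :: "complex \<Rightarrow> 'v::ab_group_add \<Rightarrow> 'v" and V d Y vac +
  fixes \<omega> :: 'v
  assumes omega_degree: "\<omega> \<in> V 4"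
    and d_omega: "d \<omega> = 0"
    and Virasoro: "\<exists>c. \<forall>m n v.
      Y \<omega> (m + 1) (Y \<omega> (n + 1) v) - Y \<omega> (n + 1) (Y \<omega> (m + 1) v)
      = s (of_int (m - n)) (Y \<omega> (m + n + 1) v)
        + s (if m + n = 0 then of_int (m ^ 3 - m) / 12 * c else 0) v"
    and weight_graded: "direct_sum s half_integers (weight_space s Y \<omega>)"
    and omega_weight: "\<omega> \<in> weight_space s Y \<omega> 2"
    and weight_finite_dim: "a \<in> half_integers \<Longrightarrow>
      \<exists>B. finite B \<and> Modules.module.span s B = weight_space s Y \<omega> a"
    and weight_bounded_below: "\<exists>N::int. \<forall>k<N. weight_space s Y \<omega> (of_int k / 2) = {0}"
    and translation: "Y \<omega> 0 v = Y v (-2) vac"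

locale weak_dg_module =
  dg_vertex_algebra sV V dV YV vac + dg_action sV V dV sM M dM YV vac YM
  for sV :: "complex \<Rightarrow> 'v::ab_group_add \<Rightarrow> 'v" and V dV YV vac
    and sM :: "complex \<Rightarrow> 'm::ab_group_add \<Rightarrow> 'm" and M dM YM

section \<open>The Zhu algebra and its bimodules\<close>

text \<open>
  \<open>residue_action s Y a k u m\<close> is \<open>Res\<^sub>z Y(u, z) (1 + z)\<^sup>a z\<^sup>-\<^sup>k m\<close>: the coefficient of \<open>z\<^sup>i\<^sup>-\<^sup>k\<close> in
  \<open>(1 + z)\<^sup>a z\<^sup>-\<^sup>k\<close> is paired with \<open>u\<^sub>i\<^sub>-\<^sub>k\<close>.
\<close>

definition residue_action ::
  "(complex \<Rightarrow> 'm \<Rightarrow> 'm) \<Rightarrow> ('v \<Rightarrow> int \<Rightarrow> 'm \<Rightarrow> 'm) \<Rightarrow> complex \<Rightarrow> int \<Rightarrow> 'v \<Rightarrow> 'm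
    \<Rightarrow> 'm::ab_group_add" where
  "residue_action s Y a k u m = Sum_any (\<lambda>i::nat. s (a gchoose i) (Y u (int i - k) m))"

text \<open>
  For \<open>M = V\<close>, \<open>O_space\<close> and \<open>left_action\<close> specialise to \<open>O(V)\<close> and to the product of \<open>A(V)\<close>.
  In \<open>left_action\<close>, \<open>u\<close> is split into its weight components, which is the extension by linearity.
\<close>

definition O_space ::
  "(complex \<Rightarrow> 'v \<Rightarrow> 'v) \<Rightarrow> ('v \<Rightarrow> int \<Rightarrow> 'v \<Rightarrow> 'v) \<Rightarrow> 'v \<Rightarrow>
   (complex \<Rightarrow> 'm \<Rightarrow> 'm) \<Rightarrow> ('v \<Rightarrow> int \<Rightarrow> 'm \<Rightarrow> 'm) \<Rightarrow> 'm::ab_group_add set" where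
  "O_space sV YV \<omega> sM YM = Modules.module.span sM
     {residue_action sM YM a 2 u m | a u m. a \<in> half_integers \<and> u \<in> weight_space sV YV \<omega> a}"

definition left_action ::
  "(complex \<Rightarrow> 'v::ab_group_add \<Rightarrow> 'v) \<Rightarrow> ('v \<Rightarrow> int \<Rightarrow> 'v \<Rightarrow> 'v) \<Rightarrow> 'v \<Rightarrow>
   (complex \<Rightarrow> 'm \<Rightarrow> 'm) \<Rightarrow> ('v \<Rightarrow> int \<Rightarrow> 'm \<Rightarrow> 'm) \<Rightarrow> 'v \<Rightarrow> 'm \<Rightarrow> 'm::ab_group_add" where
  "left_action sV YV \<omega> sM YM u m =
     Sum_any (\<lambda>a. residue_action sM YM a 1
       (component half_integers (weight_space sV YV \<omega>) u a) m)"

definition zhu_product ::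
  "(complex \<Rightarrow> 'v::ab_group_add \<Rightarrow> 'v) \<Rightarrow> ('v \<Rightarrow> int \<Rightarrow> 'v \<Rightarrow> 'v) \<Rightarrow> 'v \<Rightarrow> 'v \<Rightarrow> 'v \<Rightarrow> 'v" where
  "zhu_product s Y \<omega> = left_action s Y \<omega> s Y"

text \<open>
  Bilinear extension from bihomogeneous \<open>u\<close> and homogeneous \<open>m\<close>. The operator \<open>L(0)\<close> has
  degree 0, so a degree component of a weight vector is again a weight vector.
\<close>

definition right_action ::
  "(complex \<Rightarrow> 'v::ab_group_add \<Rightarrow> 'v) \<Rightarrow> (int \<Rightarrow> 'v set) \<Rightarrow> ('v \<Rightarrow> int \<Rightarrow> 'v \<Rightarrow> 'v) \<Rightarrow> 'v \<Rightarrow>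
   (complex \<Rightarrow> 'm \<Rightarrow> 'm) \<Rightarrow> (int \<Rightarrow> 'm set) \<Rightarrow> ('v \<Rightarrow> int \<Rightarrow> 'm \<Rightarrow> 'm) \<Rightarrow>
   'm \<Rightarrow> 'v \<Rightarrow> 'm::ab_group_add" where
  "right_action sV V YV \<omega> sM M YM m u =
     Sum_any (\<lambda>(a, p, q). sM ((-1) powi (p * q))
       (residue_action sM YM (a - 1) 1
         (component UNIV V (component half_integers (weight_space sV YV \<omega>) u a) p)
         (component UNIV M m q)))"

text \<open>
  Operations on cosets induced by operations on representatives, in the style of
  \<open>rcoset_mult\<close>. The union is a single coset precisely when \<open>f\<close> is well defined modulo \<open>U\<close> on the
  given cosets; hence closure of an induced operation includes its well-definedness.
\<close>

definition induced1 :: "'b set \<Rightarrow> ('a \<Rightarrow> 'b::ab_group_add) \<Rightarrow> 'a set \<Rightarrow> 'b set" where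
  "induced1 U f X = (\<Union>x\<in>X. f x +o U)"

definition induced2 ::
  "'c set \<Rightarrow> ('a \<Rightarrow> 'b \<Rightarrow> 'c::ab_group_add) \<Rightarrow> 'a set \<Rightarrow> 'b set \<Rightarrow> 'c set" where
  "induced2 U f X Y = (\<Union>x\<in>X. \<Union>y\<in>Y. f x y +o U)"

definition zhu_algebra ::
  "(complex \<Rightarrow> 'v::ab_group_add \<Rightarrow> 'v) \<Rightarrow> ('v \<Rightarrow> int \<Rightarrow> 'v \<Rightarrow> 'v) \<Rightarrow> 'v \<Rightarrow> 'v
    \<Rightarrow> (complex, 'v set) module" where
  "zhu_algebra s Y vac \<omega> = (let U = O_space s Y \<omega> s Y in
     \<lparr>carrier = range (\<lambda>v. v +o U),
      mult = induced2 U (zhu_product s Y \<omega>),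
      one = vac +o U,
      zero = U,
      add = induced2 U (+),
      smult = (\<lambda>c. induced1 U (s c))\<rparr>)"

text \<open>
  \<open>A(M)\<close> as a vector space; the ring multiplication and unit, which the record type requires,
  are irrelevant.
\<close>

definition zhu_bimodule ::
  "(complex \<Rightarrow> 'v::ab_group_add \<Rightarrow> 'v) \<Rightarrow> ('v \<Rightarrow> int \<Rightarrow> 'v \<Rightarrow> 'v) \<Rightarrow> 'v \<Rightarrow>
   (complex \<Rightarrow> 'm \<Rightarrow> 'm) \<Rightarrow> ('v \<Rightarrow> int \<Rightarrow> 'm \<Rightarrow> 'm) \<Rightarrow> (complex, 'm::ab_group_add set) module" where
  "zhu_bimodule sV YV \<omega> sM YM = (let U = O_space sV YV \<omega> sM YM in
     \<lparr>carrier = range (\<lambda>m. m +o U),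
      mult = undefined,
      one = undefined,
      zero = U,
      add = induced2 U (+),
      smult = (\<lambda>c. induced1 U (sM c))\<rparr>)"

definition zhu_left ::
  "(complex \<Rightarrow> 'v::ab_group_add \<Rightarrow> 'v) \<Rightarrow> ('v \<Rightarrow> int \<Rightarrow> 'v \<Rightarrow> 'v) \<Rightarrow> 'v \<Rightarrow>
   (complex \<Rightarrow> 'm \<Rightarrow> 'm) \<Rightarrow> ('v \<Rightarrow> int \<Rightarrow> 'm \<Rightarrow> 'm) \<Rightarrow> 'v set \<Rightarrow> 'm set \<Rightarrow> 'm::ab_group_add set" where
  "zhu_left sV YV \<omega> sM YM =
     induced2 (O_space sV YV \<omega> sM YM) (left_action sV YV \<omega> sM YM)"

definition zhu_right ::
  "(complex \<Rightarrow> 'v::ab_group_add \<Rightarrow> 'v) \<Rightarrow> (int \<Rightarrow> 'v set) \<Rightarrow> ('v \<Rightarrow> int \<Rightarrow> 'v \<Rightarrow> 'v) \<Rightarrow> 'v \<Rightarrow>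
   (complex \<Rightarrow> 'm \<Rightarrow> 'm) \<Rightarrow> (int \<Rightarrow> 'm set) \<Rightarrow> ('v \<Rightarrow> int \<Rightarrow> 'm \<Rightarrow> 'm) \<Rightarrow>
   'm set \<Rightarrow> 'v set \<Rightarrow> 'm::ab_group_add set" where
  "zhu_right sV V YV \<omega> sM M YM =
     induced2 (O_space sV YV \<omega> sM YM) (right_action sV V YV \<omega> sM M YM)"

section \<open>Associative algebras and bimodules over the complex numbers\<close>

definition complex_ring :: "complex ring" where
  "complex_ring = \<lparr>carrier = UNIV, mult = (*), one = 1, zero = 0, add = (+)\<rparr>"

text \<open>The library's locale \<open>algebra\<close> is restricted to commutative algebras.\<close>

locale complex_algebra = Ring.ring A + Module.module complex_ring A
  for A :: "(complex, 'a) module" (structure) +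
  assumes smult_mult_left: "x \<in> carrier A \<Longrightarrow> y \<in> carrier A \<Longrightarrow>
      (c \<odot>\<^bsub>A\<^esub> x) \<otimes>\<^bsub>A\<^esub> y = c \<odot>\<^bsub>A\<^esub> (x \<otimes>\<^bsub>A\<^esub> y)"
    and smult_mult_right: "x \<in> carrier A \<Longrightarrow> y \<in> carrier A \<Longrightarrow>
      x \<otimes>\<^bsub>A\<^esub> (c \<odot>\<^bsub>A\<^esub> y) = c \<odot>\<^bsub>A\<^esub> (x \<otimes>\<^bsub>A\<^esub> y)"

locale algebra_bimodule = A: complex_algebra A + M: Module.module complex_ring M
  for A :: "(complex, 'a) module" and M :: "(complex, 'm) module" +
  fixes left :: "'a \<Rightarrow> 'm \<Rightarrow> 'm" (infixr "\<triangleright>" 70) and right :: "'m \<Rightarrow> 'a \<Rightarrow> 'm" (infixl "\<triangleleft>" 70)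
  assumes left_closed: "a \<in> carrier A \<Longrightarrow> x \<in> carrier M \<Longrightarrow> a \<triangleright> x \<in> carrier M"
    and left_add_algebra: "a \<in> carrier A \<Longrightarrow> b \<in> carrier A \<Longrightarrow> x \<in> carrier M \<Longrightarrow>
      (a \<oplus>\<^bsub>A\<^esub> b) \<triangleright> x = (a \<triangleright> x) \<oplus>\<^bsub>M\<^esub> (b \<triangleright> x)"
    and left_add: "a \<in> carrier A \<Longrightarrow> x \<in> carrier M \<Longrightarrow> y \<in> carrier M \<Longrightarrow>
      a \<triangleright> (x \<oplus>\<^bsub>M\<^esub> y) = (a \<triangleright> x) \<oplus>\<^bsub>M\<^esub> (a \<triangleright> y)"
    and left_smult_algebra: "a \<in> carrier A \<Longrightarrow> x \<in> carrier M \<Longrightarrow>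
      (c \<odot>\<^bsub>A\<^esub> a) \<triangleright> x = c \<odot>\<^bsub>M\<^esub> (a \<triangleright> x)"
    and left_smult: "a \<in> carrier A \<Longrightarrow> x \<in> carrier M \<Longrightarrow>
      a \<triangleright> (c \<odot>\<^bsub>M\<^esub> x) = c \<odot>\<^bsub>M\<^esub> (a \<triangleright> x)"
    and left_assoc: "a \<in> carrier A \<Longrightarrow> b \<in> carrier A \<Longrightarrow> x \<in> carrier M \<Longrightarrow>
      (a \<otimes>\<^bsub>A\<^esub> b) \<triangleright> x = a \<triangleright> (b \<triangleright> x)"
    and left_one: "x \<in> carrier M \<Longrightarrow> \<one>\<^bsub>A\<^esub> \<triangleright> x = x"
    and right_closed: "a \<in> carrier A \<Longrightarrow> x \<in> carrier M \<Longrightarrow> x \<triangleleft> a \<in> carrier M"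
    and right_add_algebra: "a \<in> carrier A \<Longrightarrow> b \<in> carrier A \<Longrightarrow> x \<in> carrier M \<Longrightarrow>
      x \<triangleleft> (a \<oplus>\<^bsub>A\<^esub> b) = (x \<triangleleft> a) \<oplus>\<^bsub>M\<^esub> (x \<triangleleft> b)"
    and right_add: "a \<in> carrier A \<Longrightarrow> x \<in> carrier M \<Longrightarrow> y \<in> carrier M \<Longrightarrow>
      (x \<oplus>\<^bsub>M\<^esub> y) \<triangleleft> a = (x \<triangleleft> a) \<oplus>\<^bsub>M\<^esub> (y \<triangleleft> a)"
    and right_smult_algebra: "a \<in> carrier A \<Longrightarrow> x \<in> carrier M \<Longrightarrow>
      x \<triangleleft> (c \<odot>\<^bsub>A\<^esub> a) = c \<odot>\<^bsub>M\<^esub> (x \<triangleleft> a)"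
    and right_smult: "a \<in> carrier A \<Longrightarrow> x \<in> carrier M \<Longrightarrow>
      (c \<odot>\<^bsub>M\<^esub> x) \<triangleleft> a = c \<odot>\<^bsub>M\<^esub> (x \<triangleleft> a)"
    and right_assoc: "a \<in> carrier A \<Longrightarrow> b \<in> carrier A \<Longrightarrow> x \<in> carrier M \<Longrightarrow>
      x \<triangleleft> (a \<otimes>\<^bsub>A\<^esub> b) = (x \<triangleleft> a) \<triangleleft> b"
    and right_one: "x \<in> carrier M \<Longrightarrow> x \<triangleleft> \<one>\<^bsub>A\<^esub> = x"
    and left_right_commute: "a \<in> carrier A \<Longrightarrow> b \<in> carrier A \<Longrightarrow> x \<in> carrier M \<Longrightarrow>
      (a \<triangleright> x) \<triangleleft> b = a \<triangleright> (x \<triangleleft> b)"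

end

theory Submission
  imports Defs "HOL-Computational_Algebra.Formal_Laurent_Series"
begin

text \<open>
  Pair a field with a Laurent series by \<open>res f u w = Res\<^sub>x f(x) Y(u, x) w\<close>; truncation makes this a
  finite sum. With \<open>kern a k\<close> denoting the series \<open>(1 + x)\<^sup>a x\<^sup>-\<^sup>k\<close>, every operation in the theorem has
  this shape: for \<open>u\<close> of weight \<open>a\<close> and degree \<open>p\<close>, the generators of \<open>O(M)\<close> are
  \<open>res (kern a 2) u m\<close>, the left action is \<open>res (kern a 1) u m\<close>, and the right action is
  \<open>res (kern (a - 1) 1) u (parity p m)\<close>, where the operator \<open>parity p\<close> multiplies the component of
  degree \<open>q\<close> by \<open>(-1)\<^sup>p\<^sup>q\<close>. Carrying the sign by an operator on \<open>M\<close> keeps all expressions linear in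
  \<open>m\<close>, so that only the elements of the algebra have to be split into homogeneous components.

  Two facts do all the work. The first is the Jacobi identity for arbitrary Laurent series in place of
  powers of the variables (\<open>Jacobi_series\<close>): both sides are linear in each series and vanish when
  its order is large, so it is enough to compare them on monomials. On the iterate side
  the series \<open>f(x\<^sub>2 + y)\<close> is expanded in powers of \<open>y\<close>, and its coefficients are the Hasse derivatives
  of \<open>f\<close>. The second is that \<open>O(M)\<close> contains \<open>res (kern (a + s) k) u m\<close> whenever \<open>k \<ge> s + 2\<close>
  (\<open>res_kern_OM\<close>), a consequence of the \<open>L(-1)\<close>-derivative property.

  Let \<open>u\<close> and \<open>v\<close> have weights \<open>a\<close> and \<open>b\<close>. The three relevant cases of the Jacobi identity,
  read modulo \<open>O(M)\<close>, are the following.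

  \<^item> \<open>l = 0\<close>: the residue operators of \<open>u\<close> and \<open>v\<close> commute up to the Koszul sign, provided that the
    exponents of \<open>1 + x\<close> are small compared with the pole orders (\<open>commutator_OM\<close>). Hence both actions
    preserve \<open>O(M)\<close>, and they commute with each other.
  \<^item> \<open>l = -2\<close>: the elements \<open>u \<circ> v\<close> act by zero on both sides (\<open>iterate_2_OM\<close>), because in each of the two
    products of residues the outer operator has a pole of sufficiently high order.
  \<^item> \<open>l = -1\<close>: the element \<open>u \<^bold>* v\<close> acts like \<open>u\<close> and \<open>v\<close> in succession. On the left one product of
    residues survives (\<open>iterate_1_left_OM\<close>). On the right both do: the pole orders of \<open>v\<close> can be reduced
    to one at the price of alternating signs, and the resulting geometric series in the variable
    of \<open>u\<close> sums to \<open>1 / (1 + x)\<close>. After reordering the first product, this turns the exponent \<open>a\<close> of \<open>u\<close>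
    into the exponent \<open>a - 1\<close> of the right action (\<open>iterate_1_right_OM\<close>).

  Weights enter only as exponents of formal binomial series, which is why half-integral weights behave
  like integral ones. That \<open>O(V)\<close> is a two-sided ideal, and that \<open>A(V)\<close> is associative, is the case
  \<open>M = V\<close> of the statements about the left action.
\<close>

unbundle fps_syntax

section \<open>Finitely supported sums and direct sums\<close>

lemma Sum_any_inj:
  assumes "inj h" and "\<And>x. x \<notin> range h \<Longrightarrow> g x = 0"
  shows "Sum_any g = Sum_any (\<lambda>i. g (h i))"
proof -
  have "{x. g x \<noteq> 0} = h ` {i. g (h i) \<noteq> 0}"
    using assms(2) by fastforce
  moreover have "inj_on h {i. g (h i) \<noteq> 0}"
    using assms(1) by (rule inj_on_subset) simp
  ultimately show ?thesis
    by (simp add: Sum_any.expand_set sum.reindex)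
qed

lemma linearD:
  assumes "Vector_Spaces.linear s1 s2 f"
  shows "f (x + y) = f x + f y" and "f (s1 c x) = s2 c (f x)" and "f 0 = 0"
      and "f (x - y) = f x - f y"
proof -
  interpret Vector_Spaces.linear s1 s2 f by fact
  show "f (x + y) = f x + f y" "f (s1 c x) = s2 c (f x)" "f 0 = 0" "f (x - y) = f x - f y"
    by (simp_all add: add scale zero diff)
qed

lemma linear_Sum_any:
  assumes "Vector_Spaces.linear s1 s2 f" and "finite {i. g i \<noteq> 0}"
  shows "f (Sum_any g) = Sum_any (\<lambda>i. f (g i))"
proof -
  interpret Vector_Spaces.linear s1 s2 f by fact
  have "Sum_any (\<lambda>i. f (g i)) = (\<Sum>i\<in>{i. g i \<noteq> 0}. f (g i))"
    using assms(2) by (intro Sum_any.expand_superset) (auto simp: zero)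
  then show ?thesis
    by (simp add: Sum_any.expand_set sum)
qed

locale complex_vector_space = Vector_Spaces.vector_space s
  for s :: "complex \<Rightarrow> 'v::ab_group_add \<Rightarrow> 'v"
begin

lemma subspace_Sum_any:
  assumes "subspace S" and "\<And>i. g i \<in> S"
  shows "Sum_any g \<in> S"
  by (simp add: Sum_any.expand_set subspace_sum assms)

lemma linear_Sum_any_pointwise:
  assumes lin: "\<And>i. Vector_Spaces.linear s1 s (\<lambda>x. F x i)"
    and fin: "\<And>x. finite {i. F x i \<noteq> 0}"
    and vs: "vector_space s1"
  shows "Vector_Spaces.linear s1 s (\<lambda>x. Sum_any (F x))"
proof -
  have "F (x + y) = (\<lambda>i. F x i + F y i)" for x y
    by (rule ext) (rule linearD(1)[OF lin])
  then have "Sum_any (F (x + y)) = Sum_any (F x) + Sum_any (F y)" for x y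
    by (simp add: Sum_any.distrib[OF fin fin])
  moreover have "Sum_any (F (s1 c x)) = s c (Sum_any (F x))" for c x
  proof -
    have "Sum_any (F (s1 c x)) = Sum_any (\<lambda>i. s c (F x i))"
      by (rule Sum_any.cong) (rule linearD(2)[OF lin])
    also have "\<dots> = s c (Sum_any (F x))"
      by (rule linear_Sum_any[symmetric, OF linear_scale_self fin])
    finally show ?thesis .
  qed
  ultimately show ?thesis
    using vs vector_space_axioms by (simp add: Vector_Spaces.linear_iff)
qed

lemma ex1_decomposition: "direct_sum s I W \<Longrightarrow> \<exists>!f. decomposition I W v f"
  unfolding direct_sum_def by (drule conjunct2) (rule spec)

lemma decomposition_component:
  "direct_sum s I W \<Longrightarrow> decomposition I W v (component I W v)"
  unfolding component_def by (rule theI'[of "decomposition I W v", OF ex1_decomposition])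

lemma component_eqI:
  "direct_sum s I W \<Longrightarrow> decomposition I W v f \<Longrightarrow> component I W v = f"
  unfolding component_def by (rule the1_equality[of "decomposition I W v", OF ex1_decomposition])

lemma
  assumes "direct_sum s I W"
  shows finite_component: "finite {i. component I W v i \<noteq> 0}"
    and component_outside: "i \<notin> I \<Longrightarrow> component I W v i = 0"
    and component_mem: "i \<in> I \<Longrightarrow> component I W v i \<in> W i"
    and Sum_any_component: "Sum_any (component I W v) = v"
  using decomposition_component[OF assms, of v] by (auto simp: decomposition_def)

lemma component_homogeneous:
  assumes ds: "direct_sum s I W" and "i \<in> I" "v \<in> W i"
  shows "component I W v = (\<lambda>j. if j = i then v else 0)"
proof (rule component_eqI[OF ds])
  have "\<forall>j\<in>I. 0 \<in> W j"
    using ds by (auto simp: direct_sum_def subspace_0)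
  then show "decomposition I W v (\<lambda>j. if j = i then v else 0)"
    using assms by (auto simp: decomposition_def)
qed

lemma linear_component:
  assumes ds: "direct_sum s I W"
  shows "Vector_Spaces.linear s s (\<lambda>v. component I W v i)"
proof -
  have sub: "subspace (W i)" if "i \<in> I" for i
    using ds that by (auto simp: direct_sum_def)
  note fin = finite_component[OF ds]
  have "component I W (v + w) = (\<lambda>i. component I W v i + component I W w i)" for v w
  proof (rule component_eqI[OF ds])
    have "{i. component I W v i + component I W w i \<noteq> 0}
        \<subseteq> {i. component I W v i \<noteq> 0} \<union> {i. component I W w i \<noteq> 0}" by auto
    then show "decomposition I W (v + w) (\<lambda>i. component I W v i + component I W w i)"
      unfolding decomposition_def
      using fin sub component_mem[OF ds] component_outside[OF ds]
      by (auto simp: Sum_any.distrib Sum_any_component[OF ds] intro: subspace_add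
          dest: finite_subset)
  qed
  moreover have "component I W (s c v) = (\<lambda>i. s c (component I W v i))" for c v
  proof (rule component_eqI[OF ds])
    have "{i. s c (component I W v i) \<noteq> 0} \<subseteq> {i. component I W v i \<noteq> 0}" by auto
    then show "decomposition I W (s c v) (\<lambda>i. s c (component I W v i))"
      unfolding decomposition_def
      using fin sub component_mem[OF ds] component_outside[OF ds]
        linear_Sum_any[OF linear_scale_self fin, of c, symmetric]
      by (auto simp: Sum_any_component[OF ds] intro: subspace_scale dest: finite_subset)
  qed
  ultimately show ?thesis
    using vector_space_axioms by (simp add: Vector_Spaces.linear_iff)
qed

text \<open>
  Properties stable under addition can be checked on components. The last premise speaks of the
  components of \<open>v\<close> rather than of all homogeneous vectors, so that further knowledge about \<open>v\<close>,
  such as being a weight vector, can be transferred to them.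
\<close>

lemma direct_sum_induct [consumes 1, case_names zero add homogeneous]:
  assumes ds: "direct_sum s I W" and "P 0" and "\<And>x y. P x \<Longrightarrow> P y \<Longrightarrow> P (x + y)"
    and "\<And>i. i \<in> I \<Longrightarrow> P (component I W v i)"
  shows "P v"
proof -
  have "P (\<Sum>i\<in>F. component I W v i)" if "finite F" for F
    using that
  proof induction
    case (insert i F)
    then show ?case
      using assms(2-4) component_outside[OF ds, of i v] by (cases "i \<in> I") auto
  qed (use assms in auto)
  from this[OF finite_component[OF ds, of v]] show ?thesis
    using Sum_any_component[OF ds, of v] by (simp add: Sum_any.expand_set)
qed

end

section \<open>Binomial kernels and Hasse derivatives\<close>

text \<open>
  The series \<open>(1 + x)\<^sup>a x\<^sup>-\<^sup>k\<close>, expanded in powers of \<open>x\<close>.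
\<close>

definition kern :: "complex \<Rightarrow> int \<Rightarrow> complex fls" where
  "kern a k = fls_shift k (fps_to_fls (fps_binomial a))"

lemma kern_nth: "kern a k $$ n = (if n < - k then 0 else a gchoose nat (n + k))"
  by (auto simp: kern_def)

lemma kern_mult: "kern a k * kern b l = kern (a + b) (k + l)"
  by (simp add: kern_def fls_shifted_times_simps fps_binomial_add_mult fls_times_fps_to_fls
      fls_times_both_shifted_simp)

lemma fls_shift_kern [simp]: "fls_shift n (kern a k) = kern a (k + n)"
  by (simp add: kern_def)

lemma kern_Suc: "kern (a + 1) k = kern a k + kern a (k - 1)"
proof -
  have "kern 1 k = kern 0 k + kern 0 (k - 1)"
    by (simp add: kern_def fps_binomial_1 fls_X_conv_shift_1)
  then show ?thesis
    using kern_mult[of a 0 1 k] kern_mult[of a 0 0 k] kern_mult[of a 0 0 "k-1"]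
    by (simp add: distrib_left)
qed

lemma fls_deriv_kern: "fls_deriv (kern a k) = fls_const a * kern (a - 1) k - of_int k
  * kern a (k + 1)"
proof -
  have "fps_deriv (fps_binomial a) = fps_const a * fps_binomial (a - 1)"
    using fps_binomial_add_mult[of a "-1"]
    by (simp add: fps_binomial_deriv fps_divide_unit fps_binomial_minus_one mult.assoc)
  then show ?thesis
    by (simp add: kern_def fls_deriv_shift fls_deriv_fps_to_fls fls_times_fps_to_fls
        fls_shifted_times_simps)
qed

text \<open>
  The divided derivative \<open>f\<^sup>(\<^sup>i\<^sup>) / i!\<close>, which is the coefficient of \<open>y\<^sup>i\<close> in \<open>f(x + y)\<close>.
\<close>

definition hasse :: "nat \<Rightarrow> complex fls \<Rightarrow> complex fls" where
  "hasse i f = fls_const (1 / fact i) * (fls_deriv ^^ i) f"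

lemma hasse_0 [simp]: "hasse 0 f = f"
  by (simp add: hasse_def)

lemma fls_const_mult_assoc: "fls_const c * (fls_const d * f) = fls_const (c * d) * f"
  for f :: "'a::comm_ring_1 fls"
  by (metis fls_const_mult_const mult.assoc)

lemma hasse_Suc: "hasse (Suc i) f = fls_const (1 / of_nat (Suc i)) * fls_deriv (hasse i f)"
  by (simp add: hasse_def fls_deriv_mult_const_left fls_const_mult_assoc del: of_nat_Suc)

lemma hasse_add: "hasse i (f + g) = hasse i f + hasse i g"
  by (induction i) (simp_all add: hasse_Suc distrib_left del: of_nat_Suc)

lemma hasse_const_mult: "hasse i (fls_const c * f) = fls_const c * hasse i f"
  by (induction i) (simp_all add: hasse_Suc fls_deriv_mult_const_left mult.left_commute
      del: of_nat_Suc)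

text \<open>
  Each derivative lowers the order by at most one; this is the \<open>x\<close>-adic continuity of Hasse
  derivatives.
\<close>

lemma hasse_below: "(\<And>n. n < N \<Longrightarrow> f $$ n = 0) \<Longrightarrow> n < N - int i \<Longrightarrow> hasse i f $$ n = 0"
  by (induction i arbitrary: n) (simp_all add: hasse_Suc del: of_nat_Suc)

lemma gbinomial_Suc_complex: "a gchoose Suc i = 1 / of_nat (Suc i)
  * ((a gchoose i) * (a - of_nat i))"
  for a :: complex
  using gbinomial_mult_1[of a i] by (simp add: field_simps del: of_nat_Suc)

lemma hasse_X_intpow: "hasse i (fls_X_intpow m) = fls_const (of_int m gchoose i) * fls_X_intpow
  (m - int i)"
proof (induction i)
  case (Suc i)
  have "fls_deriv (fls_X_intpow (m - int i)) = fls_const (of_int m - of_nat i :: complex)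
      * fls_X_intpow (m - int (Suc i))"
    unfolding fls_deriv_X_intpow by (simp add: fls_of_int diff_diff_eq add.commute)
  then show ?case
    by (simp add: hasse_Suc Suc fls_deriv_mult_const_left fls_const_mult_assoc
        gbinomial_Suc_complex mult.assoc
      del: of_nat_Suc)
qed simp

lemma hasse_kern_0: "hasse i (kern a 0) = fls_const (a gchoose i) * kern (a - of_nat i) 0"
proof (induction i)
  case (Suc i)
  have "fls_deriv (kern (a - of_nat i) 0) = fls_const (a - of_nat i) * kern (a - of_nat (Suc i)) 0"
    by (simp add: fls_deriv_kern diff_diff_eq add.commute)
  then show ?case
    by (simp add: hasse_Suc Suc fls_deriv_mult_const_left fls_const_mult_assoc
        gbinomial_Suc_complex mult.assoc
      del: of_nat_Suc)
qed simp

section \<open>Continuous functionals on Laurent series\<close>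

lemma linear_comp:
  "Vector_Spaces.linear s1 s2 f \<Longrightarrow> Vector_Spaces.linear s2 s3 g \<Longrightarrow>
      Vector_Spaces.linear s1 s3 (\<lambda>x. g (f x))"
  by (simp add: Vector_Spaces.linear_iff)

lemma Sum_any_diff:
  fixes g h :: "'a \<Rightarrow> 'b::ab_group_add"
  assumes "finite {i. g i \<noteq> 0}" "finite {i. h i \<noteq> 0}"
  shows "Sum_any (\<lambda>i. g i - h i) = Sum_any g - Sum_any h"
proof -
  have "finite {i. g i - h i \<noteq> 0}"
    by (rule finite_subset[OF _ finite_UnI[OF assms]]) auto
  from Sum_any.distrib[OF this assms(2)] show ?thesis by simp
qed

context complex_vector_space
begin

lemma linear_diff_fun:
  "Vector_Spaces.linear s1 s f \<Longrightarrow> Vector_Spaces.linear s1 s g \<Longrightarrow>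
      Vector_Spaces.linear s1 s (\<lambda>x. f x - g x)"
  by (simp add: Vector_Spaces.linear_iff scale_right_diff_distrib)

lemma finite_support_scale: "finite {i. g i \<noteq> 0} \<Longrightarrow> finite {i. s (c i) (g i) \<noteq> 0}"
  by (erule finite_subset[rotated]) auto

lemma linear_scale_fun:
  "Vector_Spaces.linear s1 s f \<Longrightarrow> Vector_Spaces.linear s1 s (\<lambda>x. s c (f x))"
  by (rule linear_comp[OF _ linear_scale_self])

end

sublocale cochain_complex \<subseteq> complex_vector_space s ..

definition fls_scale :: "complex \<Rightarrow> complex fls \<Rightarrow> complex fls" where
  "fls_scale c f = fls_const c * f"

lemma vector_space_fls_scale: "vector_space fls_scale"
  by unfold_locales (simp_all add: fls_scale_def distrib_left distrib_right fls_const_mult_assoc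
      flip: fls_plus_const)

abbreviation below :: "int \<Rightarrow> complex fls \<Rightarrow> bool" where
  "below N f \<equiv> \<forall>n<N. f $$ n = 0"

context complex_vector_space
begin

text \<open>
  Linear maps that are continuous for the \<open>x\<close>-adic topology and the discrete topology on the
  target. They are determined by their values on the powers of \<open>x\<close>.
\<close>

definition functional :: "(complex fls \<Rightarrow> 'v) \<Rightarrow> bool" where
  "functional \<Phi> \<longleftrightarrow> Vector_Spaces.linear fls_scale s \<Phi> \<and> (\<exists>N. \<forall>f. below N f \<longrightarrow> \<Phi> f = 0)"

lemma functional_eq_0:
  assumes "functional \<Phi>" and "\<And>n. \<Phi> (fls_X_intpow n) = 0"
  shows "\<Phi> f = 0"
proof -
  obtain N where lin: "Vector_Spaces.linear fls_scale s \<Phi>" and N: "\<And>f. below N f \<Longrightarrow> \<Phi> f = 0"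
    using assms(1) unfolding functional_def by blast
  \<comment> \<open>Split \<open>f\<close> into a Laurent polynomial \<open>p\<close> and a tail that is too high for \<open>\<Phi>\<close> to see.\<close>
  define p where "p = (\<Sum>n\<in>{fls_subdegree f..<N}. fls_scale (f $$ n) (fls_X_intpow n))"
  have "\<Phi> p = (\<Sum>n\<in>{fls_subdegree f..<N}. \<Phi> (fls_scale (f $$ n) (fls_X_intpow n)))"
  proof -
    interpret Vector_Spaces.linear fls_scale s \<Phi> by (rule lin)
    show ?thesis unfolding p_def by (rule sum)
  qed
  then have "\<Phi> p = 0"
    by (simp add: linearD(2)[OF lin] assms(2))
  moreover have "\<Phi> (f - p) = 0"
  proof (rule N, intro allI impI)
    fix n assume "n < N"
    have "p $$ n = (\<Sum>k\<in>{fls_subdegree f..<N}. if k = n then f $$ n else 0)"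
      unfolding p_def fls_nth_sum by (intro sum.cong) (auto simp: fls_scale_def)
    then show "(f - p) $$ n = 0"
      using \<open>n < N\<close> by auto
  qed
  ultimately show ?thesis
    using linearD(1)[OF lin, of p "f - p"] by simp
qed

lemma functionalI:
  "Vector_Spaces.linear fls_scale s \<Phi> \<Longrightarrow> (\<And>f. below N f \<Longrightarrow> \<Phi> f = 0) \<Longrightarrow> functional \<Phi>"
  unfolding functional_def by blast

lemma functionalE:
  assumes "functional \<Phi>"
  obtains N where "Vector_Spaces.linear fls_scale s \<Phi>" "\<And>f. below N f \<Longrightarrow> \<Phi> f = 0"
  using assms unfolding functional_def by blast

lemma functional_diff:
  assumes "functional \<Phi>" "functional \<Psi>" shows "functional (\<lambda>f. \<Phi> f - \<Psi> f)"
proof -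
  obtain N N' where *: "Vector_Spaces.linear fls_scale s \<Phi>" "\<And>f. below N f \<Longrightarrow> \<Phi> f = 0"
    "Vector_Spaces.linear fls_scale s \<Psi>" "\<And>f. below N' f \<Longrightarrow> \<Psi> f = 0"
    using assms by (meson functionalE)
  show ?thesis
    by (rule functionalI[OF linear_diff_fun, of _ _ "max N N'"]) (simp_all add: *)
qed

lemma functional_scale:
  assumes "functional \<Phi>" shows "functional (\<lambda>f. s c (\<Phi> f))"
  using assms
proof (rule functionalE)
  fix N assume "Vector_Spaces.linear fls_scale s \<Phi>" "\<And>f. below N f \<Longrightarrow> \<Phi> f = 0"
  then show ?thesis
    by (intro functionalI[OF linear_scale_fun, of _ N]) simp_all
qed

text \<open>
  The bound \<open>k\<close> says that \<open>T\<close> lowers the order by at most \<open>k\<close>.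
\<close>

lemma functional_precomp:
  assumes "functional \<Phi>" "Vector_Spaces.linear fls_scale fls_scale T"
    and T: "\<And>f N. below (N + k) f \<Longrightarrow> below N (T f)"
  shows "functional (\<lambda>f. \<Phi> (T f))"
  using assms(1)
proof (rule functionalE)
  fix N assume *: "Vector_Spaces.linear fls_scale s \<Phi>" "\<And>f. below N f \<Longrightarrow> \<Phi> f = 0"
  show ?thesis
    by (rule functionalI[OF linear_comp[OF assms(2) *(1)], of "N + k"]) (rule *(2)[OF T])
qed

lemma functional_sum:
  assumes "finite I" "\<And>i. i \<in> I \<Longrightarrow> functional (\<Phi> i)"
  shows "functional (\<lambda>f. \<Sum>i\<in>I. \<Phi> i f)"
  using assms
proof induction
  case empty
  then show ?case
    by (simp add: functional_def Vector_Spaces.linear_iff vector_space_fls_scale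
        vector_space_axioms)
next
  case (insert i I)
  have "functional (\<lambda>f. \<Phi> i f - (- (\<Sum>i\<in>I. \<Phi> i f)))"
    using insert functional_scale[OF insert.IH, of "-1"]
    by (intro functional_diff) auto
  with insert show ?case by simp
qed

end

lemma linear_fls_shift: "Vector_Spaces.linear fls_scale fls_scale (fls_shift k)"
  by (simp add: Vector_Spaces.linear_iff vector_space_fls_scale)
      (simp add: fls_scale_def fls_shifted_times_simps)

lemma linear_fls_times: "Vector_Spaces.linear fls_scale fls_scale (\<lambda>f. g * f)"
  by (simp add: Vector_Spaces.linear_iff vector_space_fls_scale)
      (simp add: fls_scale_def algebra_simps)

lemma linear_hasse: "Vector_Spaces.linear fls_scale fls_scale (hasse i)"
  by (simp add: Vector_Spaces.linear_iff vector_space_fls_scale)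
      (simp add: fls_scale_def hasse_add hasse_const_mult)

lemma linear_fls_deriv: "Vector_Spaces.linear fls_scale fls_scale fls_deriv"
  by (simp add: Vector_Spaces.linear_iff vector_space_fls_scale)
      (simp add: fls_scale_def fls_deriv_mult_const_left)

lemma below_times:
  assumes "below (N - fls_subdegree g) f" shows "below N (g * f)"
proof (cases "f = 0")
  case False
  then have "N - fls_subdegree g \<le> fls_subdegree f"
    using assms by (intro fls_subdegree_geI) auto
  then show ?thesis by (auto intro!: fls_times_nth_eq0)
qed simp

section \<open>The Jacobi identity for Laurent series\<close>

text \<open>
  A vertex operator algebra acting on a complex \<open>M\<close>. Taking \<open>M = V\<close> is permitted, and turns
  statements about the left action into statements about the product of the Zhu algebra.
\<close>

locale zhu_module = dg_action sV V dV sM M dM YV vac Y +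
  VA: dg_vertex_operator_algebra sV V dV YV vac \<omega>
  for sV :: "complex \<Rightarrow> 'v::ab_group_add \<Rightarrow> 'v" and V dV
    and sM :: "complex \<Rightarrow> 'm::ab_group_add \<Rightarrow> 'm" and M dM YV vac Y \<omega>

text \<open>
  The coefficient of \<open>x\<^sub>1\<^sup>l\<^sup>-\<^sup>j x\<^sub>2\<^sup>j\<close> in \<open>(x\<^sub>1 - x\<^sub>2)\<^sup>l\<close>.
\<close>

definition alt_binomial :: "int \<Rightarrow> nat \<Rightarrow> complex" where
  "alt_binomial l j = (-1) ^ j * (of_int l gchoose j)"

context dg_action
begin

text \<open>
  The residue \<open>Res\<^sub>x f(x) Y(u, x) w\<close>, since \<open>Y(u, x) = \<Sum>\<^sub>n u\<^sub>n x\<^sup>-\<^sup>n\<^sup>-\<^sup>1\<close>.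
\<close>

definition res :: "complex fls \<Rightarrow> 'v \<Rightarrow> 'm \<Rightarrow> 'm" where
  "res f u w = Sum_any (\<lambda>n. sM (f $$ n) (Y u n w))"

lemma finite_res: "finite {n. sM (f $$ n) (Y u n w) \<noteq> 0}"
proof -
  obtain N where "\<forall>n\<ge>N. Y u n w = 0" using truncation by blast
  then have "{n. sM (f $$ n) (Y u n w) \<noteq> 0} \<subseteq> {fls_subdegree f..<N}"
    by (auto simp: not_less[symmetric])
  then show ?thesis by (rule finite_subset) simp
qed

lemma linear_res_series: "Vector_Spaces.linear fls_scale sM (\<lambda>f. res f u w)"
  unfolding res_def
  by (intro M.linear_Sum_any_pointwise finite_res vector_space_fls_scale)
    (simp add: Vector_Spaces.linear_iff vector_space_fls_scale M.vector_space_axioms fls_scale_def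
      M.scale_left_distrib)

lemma linear_res_left: "Vector_Spaces.linear sV sM (\<lambda>u. res f u w)"
  unfolding res_def
  by (intro M.linear_Sum_any_pointwise finite_res V.vector_space_axioms M.linear_scale_fun Y_linear)

lemma linear_res_right: "Vector_Spaces.linear sM sM (res f u)"
  unfolding res_def
  by (intro M.linear_Sum_any_pointwise finite_res M.vector_space_axioms M.linear_scale_fun
      mode_linear)

lemma res_below: "\<exists>N. \<forall>f. below N f \<longrightarrow> res f u w = 0"
proof -
  obtain N where "\<forall>n\<ge>N. Y u n w = 0" using truncation by blast
  then have "sM (f $$ n) (Y u n w) = 0" if "below N f" for f n
    using that by (cases "n < N") auto
  then have "(\<lambda>n. sM (f $$ n) (Y u n w)) = (\<lambda>_. 0)" if "below N f" for f
    using that by (intro ext)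
  then have "res f u w = 0" if "below N f" for f
    unfolding res_def using that by (simp only: Sum_any.neutral)
  then show ?thesis by blast
qed

lemma functional_res: "M.functional (\<lambda>f. res f u w)"
  unfolding M.functional_def using linear_res_series res_below by blast

lemma functional_res_shift: "M.functional (\<lambda>f. res (fls_shift k f) u w)"
  by (rule M.functional_precomp[OF functional_res linear_fls_shift, of k]) auto

lemma res_X_intpow [simp]: "res (fls_shift k 1) u w = Y u (- k) w"
proof -
  have "res (fls_shift k 1) u w = Sum_any (\<lambda>n. if n = - k then Y u n w else 0)"
    unfolding res_def by (intro Sum_any.cong) (auto simp: eq_neg_iff_add_eq_0)
  then show ?thesis by simp
qed

text \<open>
  The residue in \<open>x\<^sub>1\<close> and \<open>x\<^sub>2\<close> of \<open>f(x\<^sub>1) g(x\<^sub>2) (x\<^sub>1 - x\<^sub>2)\<^sup>l Y(u, x\<^sub>1) Y(v, x\<^sub>2) w\<close>, with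
  the power of \<open>x\<^sub>1 - x\<^sub>2\<close> expanded in nonnegative powers of \<open>x\<^sub>2\<close>.
\<close>

definition product_sum :: "int \<Rightarrow> complex fls \<Rightarrow> 'v \<Rightarrow> complex fls \<Rightarrow> 'v \<Rightarrow> 'm \<Rightarrow> 'm" where
  "product_sum l f u g v w =
    Sum_any (\<lambda>j. sM (alt_binomial l j) (res (fls_shift (int j - l) f) u
        (res (fls_shift (- int j) g) v w)))"

text \<open>
  The bound does not depend on the outer series, which gives both finiteness of the sum and its
  continuity in \<open>f\<close>.
\<close>

lemma product_sum_truncation:
  "\<exists>J. \<forall>f. \<forall>j\<ge>J. res f u (res (fls_shift (- int j) g) v w) = 0"
proof -
  obtain N where N: "\<And>f. below N f \<Longrightarrow> res f v w = 0" using res_below by blast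
  have "res (fls_shift (- int j) g) v w = 0" if "j \<ge> nat (N - fls_subdegree g)" for j
    using that by (intro N) auto
  then show ?thesis
    using linearD(3)[OF linear_res_right] by metis
qed

lemma finite_product_sum:
  "finite {j. sM (alt_binomial l j) (res (fls_shift (int j - l) f) u (res (fls_shift (- int j) g)
      v w)) \<noteq> 0}"
proof -
  obtain J where "\<forall>f. \<forall>j\<ge>J. res f u (res (fls_shift (- int j) g) v w) = 0"
    using product_sum_truncation by blast
  then have "{j. sM (alt_binomial l j) (res (fls_shift (int j - l) f) u
      (res (fls_shift (- int j) g) v w)) \<noteq> 0} \<subseteq> {..<J}"
    by (auto simp: not_less[symmetric])
  then show ?thesis by (rule finite_subset) simp
qed

lemma functional_product_sum_left: "M.functional (\<lambda>f. product_sum l f u g v w)"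
proof -
  obtain J where J: "\<forall>f. \<forall>j\<ge>J. res f u (res (fls_shift (- int j) g) v w) = 0"
    using product_sum_truncation by blast
  have "product_sum l f u g v w
      = (\<Sum>j<J. sM (alt_binomial l j) (res (fls_shift (int j - l) f) u (res (fls_shift (- int j) g)
          v w)))" for f
    unfolding product_sum_def using J by (intro Sum_any.expand_superset)
        (auto simp: not_less[symmetric])
  then show ?thesis
    by (simp add: M.functional_sum M.functional_scale[OF functional_res_shift])
qed

lemma functional_product_sum_right: "M.functional (\<lambda>g. product_sum l f u g v w)"
  unfolding M.functional_def
proof
  show "Vector_Spaces.linear fls_scale sM (\<lambda>g. product_sum l f u g v w)"
    unfolding product_sum_def
    by (intro M.linear_Sum_any_pointwise finite_product_sum vector_space_fls_scale
        M.linear_scale_fun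
        linear_comp[OF _ linear_res_right] linear_comp[OF linear_fls_shift linear_res_series])
  obtain N where N: "\<And>f. below N f \<Longrightarrow> res f v w = 0" using res_below by blast
  have "product_sum l f u g v w = 0" if "below N g" for g
    using that by (simp add: product_sum_def N linearD(3)[OF linear_res_right])
  then show "\<exists>N. \<forall>g. below N g \<longrightarrow> product_sum l f u g v w = 0" by blast
qed

end

context zhu_module
begin

lemma mode_truncation: "\<exists>J::nat. \<forall>i\<ge>J. YV u (l + int i) v = 0"
proof -
  obtain N where N: "\<forall>n\<ge>N. YV u n v = 0" using VA.truncation by blast
  have "YV u (l + int i) v = 0" if "i \<ge> nat (N - l)" for i using N that by auto
  then show ?thesis by blast
qed

text \<open>
  The residue in \<open>x\<close> and \<open>y\<close> of \<open>f(x + y) g(x) y\<^sup>l Y(Y(u, y)v, x) w\<close>, with \<open>f(x + y)\<close> expanded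
  in nonnegative powers of \<open>y\<close>.
\<close>

definition iterate_sum :: "int \<Rightarrow> complex fls \<Rightarrow> 'v \<Rightarrow> complex fls \<Rightarrow> 'v \<Rightarrow> 'm \<Rightarrow> 'm" where
  "iterate_sum l f u g v w = Sum_any (\<lambda>i::nat. res (g * hasse i f) (YV u (l + int i) v) w)"

lemma iterate_sum_finite:
  "\<exists>J. \<forall>f g. iterate_sum l f u g v w = (\<Sum>i<J. res (g * hasse i f) (YV u (l + int i) v) w)"
proof -
  obtain J where "\<forall>i\<ge>J. YV u (l + int i) v = 0" using mode_truncation by blast
  then have "iterate_sum l f u g v w = (\<Sum>i<J. res (g * hasse i f) (YV u (l + int i) v) w)" for f g
    unfolding iterate_sum_def using linearD(3)[OF linear_res_left]
    by (intro Sum_any.expand_superset) (auto simp: not_less[symmetric])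
  then show ?thesis by blast
qed

lemma functional_iterate_sum_left: "M.functional (\<lambda>f. iterate_sum l f u g v w)"
proof -
  obtain J where J: "\<And>f g. iterate_sum l f u g v w
      = (\<Sum>i<J. res (g * hasse i f) (YV u (l + int i) v) w)"
    using iterate_sum_finite by blast
  have "M.functional (\<lambda>f. res (g * hasse i f) x w)" for i x
  proof (rule M.functional_precomp[OF _ linear_hasse, where k = "int i"])
    show "M.functional (\<lambda>f. res (g * f) x w)"
      by (rule M.functional_precomp[OF functional_res linear_fls_times,
          where k = "- fls_subdegree g"])
        (rule below_times, simp)
  qed (auto intro: hasse_below[of "N + int i" for N])
  then show ?thesis unfolding J by (simp add: M.functional_sum)
qed

lemma functional_iterate_sum_right: "M.functional (\<lambda>g. iterate_sum l f u g v w)"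
proof -
  obtain J where J: "\<And>f g. iterate_sum l f u g v w
      = (\<Sum>i<J. res (g * hasse i f) (YV u (l + int i) v) w)"
    using iterate_sum_finite by blast
  have "M.functional (\<lambda>g. res (h * g) x w)" for h x
    by (rule M.functional_precomp[OF functional_res linear_fls_times,
        where k = "- fls_subdegree h"])
      (rule below_times, simp)
  then show ?thesis unfolding J by (simp add: M.functional_sum mult.commute[of _ "hasse _ _"])
qed

abbreviation koszul_sign :: "int \<Rightarrow> int \<Rightarrow> complex" where "koszul_sign p q \<equiv> (-1) powi (p * q)"

text \<open>
  For powers of \<open>x\<close> this is the Jacobi identity of the module. Both sides are continuous linear
  functionals of \<open>f\<close> and of \<open>g\<close>, so it persists for all Laurent series.
\<close>

theorem Jacobi_series:
  assumes "u \<in> V p" "v \<in> V q"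
  shows "product_sum l f u g v w - sM ((-1) powi l * koszul_sign p q) (product_sum l g v f u w)
    = iterate_sum l f u g v w"
proof -
  define \<Phi> where "\<Phi> f g = (product_sum l f u g v w
      - sM ((-1) powi l * koszul_sign p q) (product_sum l g v f u w)) - iterate_sum l f u g v w"
          for f g
  have XX: "\<Phi> (fls_X_intpow m) (fls_X_intpow n) = 0" for m n
  proof -
    have "product_sum l (fls_X_intpow m) u (fls_X_intpow n) v w
        - sM ((-1) powi l * koszul_sign p q) (product_sum l (fls_X_intpow n) v (fls_X_intpow m) u w)
      = Sum_any (\<lambda>j::nat. sM (alt_binomial l j)
          (Y u (m + l - int j) (Y v (n + int j) w)
            - sM ((-1) powi l * koszul_sign p q) (Y v (n + l - int j) (Y u (m + int j) w))))"
    proof -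
      have A: "product_sum l (fls_X_intpow m) u (fls_X_intpow n) v w
          = Sum_any (\<lambda>j. sM (alt_binomial l j) (Y u (m + l - int j) (Y v (n + int j) w)))"
              for u v m n
        by (simp add: product_sum_def algebra_simps)
      have fin: "finite {j. sM (alt_binomial l j) (Y u (m + l - int j) (Y v (n + int j) w)) \<noteq> 0}"
          for u v m n
        using finite_product_sum[of l "fls_X_intpow m" u "fls_X_intpow n" v w]
        by (simp add: algebra_simps)
      show ?thesis
        unfolding A
        by (subst linear_Sum_any[OF M.linear_scale_self fin],
            subst Sum_any_diff[OF fin M.finite_support_scale[OF fin], symmetric])
          (simp add: M.scale_right_diff_distrib mult.commute)
    qed
    also have "\<dots> = iterate_sum l (fls_X_intpow m) u (fls_X_intpow n) v w"
      unfolding alt_binomial_def Jacobi[OF assms(1,2)] iterate_sum_def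
    proof (rule Sum_any.cong)
      fix i
      have "fls_X_intpow n * hasse i (fls_X_intpow m)
          = fls_scale (of_int m gchoose i) (fls_shift (- (m + n - int i)) 1)"
        unfolding hasse_X_intpow fls_scale_def
        by (simp add: fls_X_intpow_times_conv_shift fls_shifted_times_simps diff_diff_eq)
      then show "sM (of_int m gchoose i) (Y (YV u (l + int i) v) (m + n - int i) w)
          = res (fls_X_intpow n * hasse i (fls_X_intpow m)) (YV u (l + int i) v) w"
        by (simp only: linearD(2)[OF linear_res_series] res_X_intpow minus_minus)
    qed
    finally show ?thesis by (simp add: \<Phi>_def)
  qed
  have "M.functional (\<lambda>f. \<Phi> f g)" "M.functional (\<lambda>g. \<Phi> f g)" for f g
    unfolding \<Phi>_def
    by (intro M.functional_diff M.functional_scale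
        functional_product_sum_left functional_product_sum_right
        functional_iterate_sum_left functional_iterate_sum_right)+
  then have "\<Phi> f g = 0"
    using M.functional_eq_0 XX by metis
  then show ?thesis by (simp add: \<Phi>_def)
qed

end

section \<open>Kernels, parities and weights\<close>

interpretation fls: vector_space fls_scale
  by (rule vector_space_fls_scale)

lemma linear_subspace_preimage:
  assumes "Vector_Spaces.linear s1 s2 f" and "module.subspace s2 S"
  shows "module.subspace s1 {x. f x \<in> S}"
proof -
  interpret Vector_Spaces.linear s1 s2 f by fact
  show ?thesis
    using assms(2) by (simp add: vs1.subspace_def vs2.subspace_def add scale zero)
qed

lemma half_integers_add [simp]: "a \<in> half_integers \<Longrightarrow> b \<in> half_integers \<Longrightarrow> a + b \<in> half_integers"
  unfolding half_integers_def by (auto simp: add_divide_distrib[symmetric] simp flip: of_int_add)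

lemma half_integers_of_int [simp]: "of_int n \<in> half_integers"
  unfolding half_integers_def by (rule range_eqI[of _ _ "2 * n"]) simp

lemma half_integers_diff_int [simp]: "a \<in> half_integers \<Longrightarrow> a - of_int n \<in> half_integers"
  using half_integers_add[of a "of_int (- n)"] half_integers_of_int[of "- n"] by simp

lemma minus_one_powi: "(-1 :: complex) powi n = (if even n then 1 else -1)"
  by (simp add: power_int_minus_left)

text \<open>
  By the product rule, the derivatives of \<open>(1 + x)\<^sup>a x\<^sup>-\<^sup>1\<close> are combinations of the given
  kernels: a derivative falls either on the power of \<open>1 + x\<close> or on the pole, and in the second
  case raises the pole order by one without lowering the exponent. Quantifying over the subspace
  \<open>S\<close> lets the induction pass to its preimage under differentiation.
\<close>

lemma hasse_kern_1_mem:
  assumes "fls.subspace S" and "\<And>t. kern (a - of_nat i + of_nat t) (1 + int t) \<in> S"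
  shows "hasse i (kern a 1) \<in> S"
  using assms
proof (induction i arbitrary: S)
  case 0
  from "0.prems"(2)[of 0] show ?case by simp
next
  case (Suc i)
  have "hasse i (kern a 1) \<in> {f. fls_deriv f \<in> S}"
  proof (rule Suc.IH)
    show "fls.subspace {f. fls_deriv f \<in> S}"
      by (rule linear_subspace_preimage[OF linear_fls_deriv Suc.prems(1)])
    fix t
    have "fls_deriv (kern (a - of_nat i + of_nat t) (1 + int t))
      = fls_scale (a - of_nat i + of_nat t) (kern (a - of_nat (Suc i) + of_nat t) (1 + int t))
        - fls_scale (of_nat (Suc t)) (kern (a - of_nat (Suc i) + of_nat (Suc t)) (1 + int (Suc t)))"
      unfolding fls_deriv_kern fls_scale_def by (simp add: fls_of_int algebra_simps)
    also have "\<dots> \<in> S"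
      using Suc.prems by (intro fls.subspace_diff fls.subspace_scale)
    finally show "kern (a - of_nat i + of_nat t) (1 + int t) \<in> {f. fls_deriv f \<in> S}" by simp
  qed
  then show ?case
    using fls.subspace_scale[OF Suc.prems(1)] by (simp add: hasse_Suc flip: fls_scale_def)
qed

context cochain_complex
begin

lemma linear_eqI_graded:
  assumes "Vector_Spaces.linear s s' f" "Vector_Spaces.linear s s' g"
    and "\<And>p x. x \<in> V p \<Longrightarrow> f x = g x"
  shows "f x = g x"
proof (rule direct_sum_induct[OF graded, of "\<lambda>x. f x = g x"])
  show "f 0 = g 0" "f x = g x \<Longrightarrow> f y = g y \<Longrightarrow> f (x + y) = g (x + y)" for x y
    using linearD(1,3)[OF assms(1)] linearD(1,3)[OF assms(2)] by auto
  show "f (component UNIV V x p) = g (component UNIV V x p)" for p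
    by (rule assms(3)[OF component_mem[OF graded UNIV_I]])
qed

text \<open>
  In particular \<open>L(0)\<close> commutes with the projections, so degree components of weight vectors are
  weight vectors.
\<close>

lemma component_degree_0:
  assumes "Vector_Spaces.linear s s f" and "\<And>p x. x \<in> V p \<Longrightarrow> f x \<in> V p"
  shows "component UNIV V (f x) p = f (component UNIV V x p)"
proof -
  have "component UNIV V (f x) = (\<lambda>p. f (component UNIV V x p))"
  proof (rule component_eqI[OF graded])
    have "finite {p. f (component UNIV V x p) \<noteq> 0}"
      by (rule finite_subset[OF _ finite_component[OF graded, of x]])
          (auto simp: linearD(3)[OF assms(1)])
    then show "decomposition UNIV V (f x) (\<lambda>p. f (component UNIV V x p))"
      using linear_Sum_any[OF assms(1) finite_component[OF graded, of x]]
      by (simp add: decomposition_def assms(2) component_mem[OF graded]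
          Sum_any_component[OF graded])
  qed
  then show ?thesis by simp
qed

text \<open>
  The operator \<open>(-1)\<^sup>p\<^sup>q\<close> on degree \<open>q\<close>: it carries the sign of the right action by an element
  of degree \<open>p\<close>.
\<close>

definition parity :: "int \<Rightarrow> 'v \<Rightarrow> 'v" where
  "parity p x = Sum_any (\<lambda>q. s ((-1) powi (p * q)) (component UNIV V x q))"

lemma linear_parity: "Vector_Spaces.linear s s (parity p)"
  unfolding parity_def
  by (intro linear_Sum_any_pointwise finite_support_scale finite_component[OF graded]
      vector_space_axioms
      linear_scale_fun linear_component[OF graded])

lemma parity_homogeneous: "x \<in> V q \<Longrightarrow> parity p x = s ((-1) powi (p * q)) x"
proof -
  assume "x \<in> V q"
  then have "parity p x = Sum_any (\<lambda>r. if r = q then s ((-1) powi (p * r)) x else 0)"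
    unfolding parity_def by (intro Sum_any.cong) (simp add: component_homogeneous[OF graded])
  then show ?thesis by simp
qed

lemma parity_parity: "parity p (parity q x) = parity (p + q) x"
  by (rule linear_eqI_graded[OF linear_comp[OF linear_parity linear_parity] linear_parity])
    (auto simp: parity_homogeneous linearD(2)[OF linear_parity] minus_one_powi)

lemma parity_even: "parity (p - 2 * q) x = parity p x"
  by (simp add: parity_def minus_one_powi)

lemma parity_0: "parity 0 x = x"
  by (simp add: parity_def Sum_any_component[OF graded])

end

context dg_action
begin

lemma residue_action_eq_res: "residue_action sM Y a k u m = res (kern a k) u m"
proof -
  have "res (kern a k) u m = Sum_any (\<lambda>i::nat. sM (kern a k $$ (int i - k)) (Y u (int i - k) m))"
    unfolding res_def
  proof (rule Sum_any_inj)
    show "inj (\<lambda>i. int i - k)" by (rule injI) simp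
    fix n assume "n \<notin> range (\<lambda>i. int i - k)"
    moreover have "n = int (nat (n + k)) - k" if "n \<ge> - k" using that by simp
    ultimately have "n < - k" by (metis not_le rangeI)
    then show "sM (kern a k $$ n) (Y u n m) = 0" by (simp add: kern_nth)
  qed
  then show ?thesis by (simp add: residue_action_def kern_nth)
qed

lemma zero_gbinomial: "(0 :: complex) gchoose i = (if i = 0 then 1 else 0)"
  by (cases i) simp_all

lemma one_gbinomial: "(1 :: complex) gchoose i = (if i \<le> 1 then 1 else 0)"
  by (induction i) (auto simp: gbinomial_Suc_complex le_Suc_eq)

text \<open>
  The Jacobi identity for \<open>l = 0\<close> and \<open>m = 1\<close>; with the conformal vector as \<open>u\<close> it computes the
  commutator of \<open>L(0)\<close> with a mode.
\<close>

lemma commutator_1: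
  assumes "u \<in> V p" "v \<in> V q"
  shows "Y u 1 (Y v n w) - sM ((-1) powi (p * q)) (Y v n (Y u 1 w))
    = Y (YV u 0 v) (n + 1) w + Y (YV u 1 v) n w"
proof -
  have "Sum_any (\<lambda>i::nat. sM ((-1) ^ i * (of_int 0 gchoose i))
          (Y u (1 + 0 - int i) (Y v (n + int i) w)
            - sM ((-1) powi 0 * (-1) powi (p * q)) (Y v (n + 0 - int i) (Y u (1 + int i) w))))
      = Sum_any (\<lambda>i::nat. if i = 0 then Y u 1 (Y v n w) - sM ((-1) powi (p * q)) (Y v n (Y u 1 w))
          else 0)"
    by (intro Sum_any.cong) (simp add: zero_gbinomial)
  moreover have "Sum_any (\<lambda>i::nat. sM (of_int 1 gchoose i) (Y (YV u (0 + int i) v) (1 + n - int i)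
      w))
      = (\<Sum>i\<in>{0,1}. sM (of_int 1 gchoose i) (Y (YV u (0 + int i) v) (1 + n - int i) w))"
    by (intro Sum_any.expand_superset) (auto simp: one_gbinomial)
  ultimately show ?thesis
    using Jacobi[OF assms, of 0 1 n w] by (simp add: one_gbinomial add.commute)
qed

text \<open>
  The \<open>L(-1)\<close>-derivative property \<open>Y(L(-1)u, x) = d/dx Y(u, x)\<close> on a module is the Jacobi
  identity for \<open>l = -2\<close>, \<open>m = 0\<close> applied to \<open>u\<close> and the vacuum, because \<open>L(-1)u = u\<^sub>-\<^sub>2\<one>\<close>.
\<close>

lemma translation_mode_homogeneous:
  assumes "vac \<in> V 0" "u \<in> V p"
  shows "Y (YV u (-2) vac) n w = - sM (of_int n) (Y u (n - 1) w)"
proof -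
  have coeff: "(-1) ^ i * (of_int (-2) gchoose i) = (of_nat (i + 1) :: complex)" for i
  proof (induction i)
    case (Suc i)
    have "(-1) ^ Suc i * (of_int (-2) gchoose Suc i) = - (1 / of_nat (Suc i)) * (-2 - of_nat i)
        * ((-1) ^ i * (of_int (-2) gchoose i) :: complex)"
      by (simp add: gbinomial_Suc_complex)
    also have "\<dots> = of_nat (Suc i + 1)"
      unfolding Suc by (simp add: field_simps del: of_nat_Suc) (simp add: field_simps)
    finally show ?case .
  qed simp
  have "Sum_any (\<lambda>i::nat. sM (of_int 0 gchoose i) (Y (YV u (-2 + int i) vac) (0 + n - int i) w))
      = Sum_any (\<lambda>i::nat. if i = 0 then Y (YV u (-2) vac) n w else 0)"
    by (intro Sum_any.cong) (simp add: zero_gbinomial)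
  then have "Y (YV u (-2) vac) n w = Sum_any (\<lambda>i::nat. sM ((-1) ^ i * (of_int (-2) gchoose i))
          (Y u (0 + -2 - int i) (Y vac (n + int i) w)
            - sM ((-1) powi -2 * (-1) powi (p * 0)) (Y vac (n + -2 - int i) (Y u (0 + int i) w))))"
    using Jacobi[OF assms(2,1), of "-2" 0 n w] by simp
  also have "\<dots> = Sum_any (\<lambda>i. if i = nat (\<bar>n\<bar> - 1) then - sM (of_int n) (Y u (n - 1) w) else 0)"
  proof (rule Sum_any.cong)
    fix i
    \<comment> \<open>The modes of the vacuum vanish except for index \<open>-1\<close>, so at most one term survives: for
      negative \<open>n\<close> in the first product, for positive \<open>n\<close> in the second.\<close>
    consider "n + int i = -1" | "n - 2 - int i = -1" | "n + int i \<noteq> -1" "n - 2 - int i \<noteq> -1"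
        by blast
    then show "sM ((-1) ^ i * (of_int (-2) gchoose i))
          (Y u (0 + -2 - int i) (Y vac (n + int i) w)
            - sM ((-1) powi -2 * (-1) powi (p * 0)) (Y vac (n + -2 - int i) (Y u (0 + int i) w)))
        = (if i = nat (\<bar>n\<bar> - 1) then - sM (of_int n) (Y u (n - 1) w) else 0)"
    proof cases
      case 1
      then have n: "n = - 1 - int i" by simp
      have "sM (1 + of_nat i) x = - sM (- 1 - of_nat i) x" for x
        using M.scale_minus_left[of "- 1 - of_nat i" x] by (simp add: add.commute)
      then show ?thesis unfolding coeff by (simp add: vacuum n)
    next
      case 2
      then have n: "n = int i + 1" by simp
      show ?thesis unfolding coeff by (simp add: vacuum n linearD(3)[OF mode_linear]
          M.scale_right_diff_distrib add.commute)
    next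
      case 3
      then have "n = 0" if "i = nat (\<bar>n\<bar> - 1)" using that by linarith
      with 3 show ?thesis unfolding coeff by (auto simp: vacuum linearD(3)[OF mode_linear])
    qed
  qed
  finally show ?thesis by simp
qed

text \<open>
  Modes of \<open>u\<close> shift degrees by \<open>p\<close> up to an even number, so moving the sign operator past them
  costs the Koszul sign.
\<close>

lemma parity_mode:
  assumes "u \<in> V p"
  shows "M.parity q (Y u n m) = sM ((-1) powi (p * q)) (Y u n (M.parity q m))"
proof (rule M.linear_eqI_graded[OF linear_comp[OF mode_linear M.linear_parity]
      M.linear_scale_fun[OF linear_comp[OF M.linear_parity mode_linear]]])
  fix r x assume x: "x \<in> M r"
  show "M.parity q (Y u n x) = sM ((-1) powi (p * q)) (Y u n (M.parity q x))"
    by (simp add: M.parity_homogeneous[OF mode_degree[OF assms x]] M.parity_homogeneous[OF x]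
        linearD(2)[OF mode_linear] minus_one_powi)
qed

lemma parity_res:
  assumes "u \<in> V p"
  shows "M.parity q (res f u m) = sM ((-1) powi (p * q)) (res f u (M.parity q m))"
  unfolding res_def
  by (simp add: linear_Sum_any[OF M.linear_parity finite_res]
      linear_Sum_any[OF M.linear_scale_self finite_res]
      parity_mode[OF assms] linearD(2)[OF M.linear_parity] mult.commute)

end

context zhu_module
begin

abbreviation wt where "wt \<equiv> weight_space sV YV \<omega>"

section \<open>The subspace O(M)\<close>

definition OM where "OM = O_space sV YV \<omega> sM Y"

lemma subspace_OM: "M.subspace OM"
  by (simp add: OM_def O_space_def)

lemmas OM_closed = M.subspace_0[OF subspace_OM] M.subspace_add[OF subspace_OM]
  M.subspace_diff[OF subspace_OM] M.subspace_scale[OF subspace_OM]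

lemma component_wt: "u \<in> wt a \<Longrightarrow> component UNIV V u p \<in> wt a"
proof -
  assume u: "u \<in> wt a"
  have "YV \<omega> 1 (component UNIV V u p) = component UNIV V (YV \<omega> 1 u) p"
    using VA.mode_degree[OF VA.omega_degree, of _ _ 1]
    by (intro V.component_degree_0[OF VA.mode_linear, symmetric]) fastforce
  with u show ?thesis
    by (simp add: weight_space_def linearD(2)[OF V.linear_component[OF V.graded]])
qed

lemma weight_induct [consumes 1, case_names zero add homogeneous]:
  assumes "u \<in> wt a" "P 0" "\<And>x y. P x \<Longrightarrow> P y \<Longrightarrow> P (x + y)" "\<And>p x. x \<in> wt a \<Longrightarrow> x \<in> V p \<Longrightarrow> P x"
  shows "P u"
  by (rule V.direct_sum_induct[OF V.graded, of P, OF assms(2,3)])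
    (use assms(1,4) component_wt V.component_mem[OF V.graded] in blast)+

lemma bihomogeneous_induct [case_names zero add homogeneous]:
  assumes "P 0" "\<And>x y. P x \<Longrightarrow> P y \<Longrightarrow> P (x + y)"
    "\<And>a p x. a \<in> half_integers \<Longrightarrow> x \<in> wt a \<Longrightarrow> x \<in> V p \<Longrightarrow> P x"
  shows "P u"
proof (rule V.direct_sum_induct[OF VA.weight_graded, of P, OF assms(1,2)])
  fix a :: complex assume "a \<in> half_integers"
  then show "P (component half_integers wt u a)"
    using V.component_mem[OF VA.weight_graded] assms by (blast intro: weight_induct[where P = P])
qed

text \<open>
  \<open>[L(0), u\<^sub>n] = (L(-1)u)\<^sub>n\<^sub>+\<^sub>1 + (L(0)u)\<^sub>n = -(n + 1) u\<^sub>n + a u\<^sub>n\<close>; no sign occurs since the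
  conformal vector is even.
\<close>

lemma wt_mode:
  assumes "u \<in> wt a" "u \<in> V p" "v \<in> wt b"
  shows "YV u n v \<in> wt (a + b - of_int n - 1)"
proof -
  have "YV \<omega> 1 (YV u n v) - YV u n (YV \<omega> 1 v) = YV (YV \<omega> 0 u) (n + 1) v + YV (YV \<omega> 1 u) n v"
    using VA.commutator_1[OF VA.omega_degree assms(2)] by simp
  also have "YV (YV \<omega> 0 u) (n + 1) v = - sV (of_int (n + 1)) (YV u n v)"
    using VA.translation_mode_homogeneous[OF VA.vac_degree assms(2), of "n + 1"]
        by (simp add: VA.translation)
  finally have "YV \<omega> 1 (YV u n v)
      = YV u n (sV b v) - sV (of_int (n + 1)) (YV u n v) + YV (sV a u) n v"
    using assms by (simp add: weight_space_def algebra_simps)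
  then show ?thesis
    by (simp add: weight_space_def linearD(2)[OF VA.mode_linear] linearD(2)[OF VA.Y_linear]
        V.scale_left_distrib V.scale_left_diff_distrib)
qed

lemma deg_mode:
  assumes "u \<in> V p" "v \<in> V q"
  shows "YV u n v \<in> V (p + q - 2 * (n + 1))"
  using VA.mode_degree[OF assms, of n] by (simp add: algebra_simps)

lemma wt_translation: "u \<in> wt a \<Longrightarrow> YV u (-2) vac \<in> wt (a + 1)"
proof -
  assume u: "u \<in> wt a"
  obtain c where "\<And>m n v. YV \<omega> (m + 1) (YV \<omega> (n + 1) v) - YV \<omega> (n + 1) (YV \<omega> (m + 1) v)
      = sV (of_int (m - n)) (YV \<omega> (m + n + 1) v)
        + sV (if m + n = 0 then of_int (m ^ 3 - m) / 12 * c else 0) v"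
    using VA.Virasoro by blast
  from this[of 0 "-1" u] u have "YV \<omega> 1 (YV \<omega> 0 u) - sV a (YV \<omega> 0 u) = YV \<omega> 0 u"
    by (simp add: weight_space_def linearD(2)[OF VA.mode_linear])
  then show ?thesis
    by (simp add: weight_space_def VA.translation V.scale_left_distrib algebra_simps)
qed

lemma translation_mode: "Y (YV u (-2) vac) n w = - sM (of_int n) (Y u (n - 1) w)"
proof (rule V.linear_eqI_graded[where f = "\<lambda>u. Y (YV u (-2) vac) n w"
    and g = "\<lambda>u. - sM (of_int n) (Y u (n - 1) w)"])
  show "Vector_Spaces.linear sV sM (\<lambda>u. Y (YV u (-2) vac) n w)"
    by (rule linear_comp[OF VA.Y_linear Y_linear])
  have "Vector_Spaces.linear sV sM (\<lambda>u. sM (- of_int n) (Y u (n - 1) w))"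
    by (rule M.linear_scale_fun[OF Y_linear])
  then show "Vector_Spaces.linear sV sM (\<lambda>u. - sM (of_int n) (Y u (n - 1) w))"
    by simp
qed (rule translation_mode_homogeneous[OF VA.vac_degree])

text \<open>
  Integration by parts, for a residue.
\<close>

lemma res_translation: "res f (YV u (-2) vac) w = - res (fls_deriv f) u w"
proof -
  have "res f (YV u (-2) vac) w - (- res (fls_deriv f) u w) = 0"
  proof (rule M.functional_eq_0[where \<Phi> = "\<lambda>f. res f (YV u (-2) vac) w
      - (- res (fls_deriv f) u w)"])
    have "M.functional (\<lambda>f. sM (-1) (res (fls_deriv f) u w))"
      by (rule M.functional_scale[OF M.functional_precomp[OF functional_res linear_fls_deriv,
          where k = 1]]) auto
    then show "M.functional (\<lambda>f. res f (YV u (-2) vac) w - (- res (fls_deriv f) u w))"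
      by (intro M.functional_diff functional_res) simp
    fix n
    have "fls_deriv (fls_X_intpow n) = fls_scale (of_int n) (fls_X_intpow (n - 1))"
      unfolding fls_deriv_X_intpow by (simp add: fls_scale_def fls_of_int)
    then have "res (fls_deriv (fls_X_intpow n)) u w = sM (of_int n) (Y u (n - 1) w)"
      by (simp only: linearD(2)[OF linear_res_series] res_X_intpow minus_minus)
    then show "res (fls_X_intpow n) (YV u (-2) vac) w - (- res (fls_deriv (fls_X_intpow n)) u w)
        = 0"
      by (simp add: translation_mode)
  qed
  then show ?thesis by (simp add: eq_neg_iff_add_eq_0)
qed

lemma res_kern_OM_2: "a \<in> half_integers \<Longrightarrow> u \<in> wt a \<Longrightarrow> res (kern a 2) u m \<in> OM"
  unfolding OM_def O_space_def by (rule M.span_base) (auto simp: residue_action_eq_res)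

text \<open>
  The pole order is raised by applying the induction hypothesis to \<open>L(-1)u\<close>, which has weight
  \<open>a + 1\<close>: its residue is that of \<open>u\<close> against the derivative of \<open>kern (a + 1) k\<close>, a combination
  of \<open>kern a k\<close> and \<open>kern a (k + 1)\<close> in which the latter has the nonzero coefficient \<open>-k\<close>.
\<close>

lemma res_kern_OM_base:
  assumes "a \<in> half_integers" "u \<in> wt a" "k \<ge> 2"
  shows "res (kern a k) u m \<in> OM"
  using assms(3,1,2)
proof (induction k arbitrary: a u rule: int_ge_induct)
  case base
  then show ?case by (rule res_kern_OM_2)
next
  case (step k)
  have "fls_deriv (kern (a + 1) k) = fls_scale (a + 1 - of_int k) (kern a k) - fls_scale
      (of_int k) (kern a (k + 1))"
    using kern_Suc[of a "k + 1"]
    by (simp add: fls_deriv_kern fls_scale_def fls_of_int algebra_simps flip: fls_plus_const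
        fls_minus_const)
  then have "res (kern (a + 1) k) (YV u (-2) vac) m
      = sM (of_int k) (res (kern a (k + 1)) u m) - sM (a + 1 - of_int k) (res (kern a k) u m)"
    by (simp add: res_translation linearD[OF linear_res_series])
  moreover have "res (kern (a + 1) k) (YV u (-2) vac) m \<in> OM"
    using step.IH[OF _ wt_translation[OF step.prems(2)]] step.prems
        half_integers_add[OF _ half_integers_of_int[of 1], of a]
    by simp
  ultimately have "sM (of_int k) (res (kern a (k + 1)) u m) \<in> OM"
    using OM_closed(2) OM_closed(4)[OF step.IH[OF step.prems]] by (metis diff_add_cancel)
  from OM_closed(4)[OF this, of "1 / of_int k"] show ?case
    using step.hyps by simp
qed

text \<open>
  A factor \<open>1 + x\<close> costs at most one pole order.
\<close>

lemma res_kern_OM: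
  assumes "a \<in> half_integers" "u \<in> wt a" "k \<ge> int s + 2"
  shows "res (kern (a + of_nat s) k) u m \<in> OM"
  using assms(3)
proof (induction s arbitrary: k)
  case 0
  then show ?case using res_kern_OM_base assms by simp
next
  case (Suc s)
  have "kern (a + of_nat (Suc s)) k = kern (a + of_nat s) k + kern (a + of_nat s) (k - 1)"
    using kern_Suc[of "a + of_nat s" k] by (simp add: add_ac)
  then show ?case
    using Suc by (simp add: linearD(1)[OF linear_res_series] OM_closed)
qed

end

section \<open>Commutators and iterates modulo O(M)\<close>

lemma alt_binomial_minus_1: "alt_binomial (-1) j = 1"
proof (induction j)
  case (Suc j)
  have "alt_binomial (-1) (Suc j) = (1 + of_nat j) / of_nat (Suc j) * alt_binomial (-1) j"
    by (simp add: alt_binomial_def gbinomial_Suc_complex field_simps)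
  with Suc of_nat_neq_0[of j, where 'a = complex] show ?case by simp
qed (simp add: alt_binomial_def)

text \<open>
  The partial sums of \<open>(1 + x)\<^sup>a\<^sup>+\<^sup>1 (1 - x + x\<^sup>2 - \<dots>) = (1 + x)\<^sup>a\<close>.
\<close>

lemma kern_telescope: "(\<Sum>j<J. fls_scale ((-1) ^ j) (kern (a + 1) (- int j)))
    = kern a 0 - fls_scale ((-1) ^ J) (kern a (- int J))"
proof (induction J)
  case (Suc J)
  have "kern (a + 1) (- int J) = kern a (- int J) + kern a (- int (Suc J))"
  proof -
    have "- int J - 1 = - int (Suc J)" by simp
    with kern_Suc[of a "- int J"] show ?thesis by (simp only:)
  qed
  with Suc show ?case by (simp add: fls_scale_def algebra_simps)
qed (simp add: fls_scale_def)

lemma half_integers_mode: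
  "a \<in> half_integers \<Longrightarrow> b \<in> half_integers \<Longrightarrow> a + b - of_int n - 1 \<in> half_integers"
  using half_integers_diff_int[OF half_integers_diff_int[OF half_integers_add], of a b n 1] by simp

context complex_vector_space
begin

lemma Sum_any_minus_0_mem:
  fixes g :: "nat \<Rightarrow> 'v"
  assumes "subspace S" "finite {j. g j \<noteq> 0}" "\<And>j. j > 0 \<Longrightarrow> g j \<in> S"
  shows "Sum_any g - g 0 \<in> S"
proof -
  have "Sum_any g = g 0 + Sum_any (\<lambda>j. if j = 0 then 0 else g j)"
  proof -
    have "finite {j. (if j = 0 then 0 else g j) \<noteq> 0}"
      by (rule finite_subset[OF _ assms(2)]) auto
    from Sum_any.update[OF this, of 0 "g 0"]
    have "Sum_any ((\<lambda>j. if j = 0 then 0 else g j)(0 := g 0)) = g 0 + Sum_any (\<lambda>j.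
        if j = 0 then 0 else g j)"
      by simp
    moreover have "(\<lambda>j. if j = 0 then 0 else g j)(0 := g 0) = g" by auto
    ultimately show ?thesis by (simp only:)
  qed
  moreover have "Sum_any (\<lambda>j. if j = 0 then 0 else g j) \<in> S"
    using assms by (intro subspace_Sum_any) (auto simp: subspace_0)
  ultimately show ?thesis by simp
qed

end

context zhu_module
begin

lemma product_sum_OM:
  assumes "\<And>j y. res (fls_shift (int j - l) f) u y \<in> OM"
  shows "product_sum l f u g v w \<in> OM"
  unfolding product_sum_def by (intro M.subspace_Sum_any subspace_OM OM_closed assms)

text \<open>
  The commutator is a sum of residues of the vectors \<open>u\<^sub>i v\<close>, of weight \<open>a + b - i - 1\<close>, against
  \<open>kern (a' + b' - i + t) (k + 1 + t)\<close>. The exponent exceeds the weight by \<open>r + t\<close>, and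
  \<open>k \<ge> r + 1\<close> is exactly what \<open>res_kern_OM\<close> then asks of the pole order.
\<close>

lemma commutator_OM:
  assumes u: "a \<in> half_integers" "u \<in> wt a" "u \<in> V p"
    and v: "b \<in> half_integers" "v \<in> wt b" "v \<in> V q"
    and weights: "a' + b' = a + b - 1 + of_nat r" and k: "k \<ge> int r + 1"
  shows "res (kern a' 1) u (res (kern b' k) v w) - sM (koszul_sign p q)
      (res (kern b' k) v (res (kern a' 1) u w)) \<in> OM"
proof -
  have *: "product_sum 0 f x g y w = res f x (res g y w)" for f x g y
  proof -
    have "product_sum 0 f x g y w
      = Sum_any (\<lambda>j::nat. if j = 0 then res f x (res g y w) else 0)"
      unfolding product_sum_def by (intro Sum_any.cong) (simp add: alt_binomial_def zero_gbinomial)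
    then show ?thesis by simp
  qed
  have a': "a' = a + b - 1 + of_nat r - b'"
    using weights by (simp add: eq_diff_eq)
  have "iterate_sum 0 (kern a' 1) u (kern b' k) v w \<in> OM"
    unfolding iterate_sum_def
  proof (rule M.subspace_Sum_any[OF subspace_OM])
    fix i
    let ?x = "YV u (0 + int i) v"
    have "hasse i (kern a' 1) \<in> {h. res (kern b' k * h) ?x w \<in> OM}"
    proof (rule hasse_kern_1_mem)
      show "fls.subspace {h. res (kern b' k * h) ?x w \<in> OM}"
        by (rule linear_subspace_preimage[OF linear_comp[OF linear_fls_times linear_res_series]
            subspace_OM])
      fix t
      have "kern b' k * kern (a' - of_nat i + of_nat t) (1 + int t)
          = kern ((a + b - of_int (int i) - 1) + of_nat (r + t)) (k + 1 + int t)"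
        unfolding a' kern_mult by (simp add: algebra_simps)
      moreover have "res (kern ((a + b - of_int (int i) - 1) + of_nat (r + t)) (k + 1 + int t)) ?x
          w \<in> OM"
        using wt_mode[OF u(2,3) v(2), of "int i"] k
        by (intro res_kern_OM half_integers_mode[OF u(1) v(1)]) auto
      ultimately show "kern (a' - of_nat i + of_nat t) (1 + int t) \<in> {h. res (kern b' k * h) ?x w
          \<in> OM}"
        by simp
    qed
    then show "res (kern b' k * hasse i (kern a' 1)) ?x w \<in> OM" by simp
  qed
  then show ?thesis
    using Jacobi_series[OF u(3) v(3), of 0 "kern a' 1" "kern b' k" w] by (simp add: *)
qed

text \<open>
  The elements \<open>u \<circ> v\<close> (\<open>k = 2\<close>) and \<open>u \<^bold>* v\<close> (\<open>k = 1\<close>) act through residues of their components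
  \<open>u\<^sub>i\<^sub>-\<^sub>k v\<close>, whose weights depend on \<open>i\<close>. The exponents fit together because the Hasse
  derivatives of \<open>(1 + x)\<^sup>a\<close> are the binomial multiples of \<open>(1 + x)\<^sup>a\<^sup>-\<^sup>i\<close>. The shift \<open>e\<close> is \<open>0\<close>
  for the left and \<open>-1\<close> for the right action; the vector \<open>w\<close> may depend on the parity of
  \<open>p + q\<close>, which is the common parity of all these components.
\<close>

lemma linear_iterate_residue:
  assumes u: "a \<in> half_integers" "u \<in> wt a" "u \<in> V p"
    and v: "b \<in> half_integers" "v \<in> wt b" "v \<in> V q"
    and L: "Vector_Spaces.linear sV sM L"
    and L_eq: "\<And>c j x. c \<in> half_integers \<Longrightarrow> x \<in> wt c \<Longrightarrow> x \<in> V (p + q - 2 * j) \<Longrightarrow>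
        L x = res (kern (c + e) 1) x w"
  shows "L (residue_action sV YV a k u v) = iterate_sum (- k) (kern a 0) u
      (kern (b + e + of_int k - 1) 1) v w"
proof -
  have fin: "finite {i::nat. sV (a gchoose i) (YV u (int i - k) v) \<noteq> 0}"
  proof -
    obtain J where "\<forall>i\<ge>J. YV u (- k + int i) v = 0" using mode_truncation by blast
    then have "{i. sV (a gchoose i) (YV u (int i - k) v) \<noteq> 0} \<subseteq> {..<J}"
      by (auto simp: not_less[symmetric])
    then show ?thesis by (rule finite_subset) simp
  qed
  have "L (residue_action sV YV a k u v) = Sum_any (\<lambda>i. L (sV (a gchoose i) (YV u (int i - k) v)))"
    unfolding residue_action_def by (rule linear_Sum_any[OF L fin])
  also have "\<dots> = iterate_sum (- k) (kern a 0) u (kern (b + e + of_int k - 1) 1) v w"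
    unfolding iterate_sum_def
  proof (rule Sum_any.cong)
    fix i
    let ?x = "YV u (int i - k) v"
    have "L ?x = res (kern ((a + b - of_int (int i - k) - 1) + e) 1) ?x w"
      by (rule L_eq[OF half_integers_mode[OF u(1) v(1)] wt_mode[OF u(2,3) v(2)]
          deg_mode[OF u(3) v(3)]])
    moreover have "kern (b + e + of_int k - 1) 1 * hasse i (kern a 0)
        = fls_scale (a gchoose i) (kern ((a + b - of_int (int i - k) - 1) + e) 1)"
    proof -
      have "(b + e + of_int k - 1) + (a - of_nat i) = (a + b - of_int (int i - k) - 1) + e"
        by simp
      then show ?thesis
        unfolding hasse_kern_0 fls_scale_def
        by (metis kern_mult mult.left_commute add_0_right)
    qed
    ultimately show "L (sV (a gchoose i) ?x)
        = res (kern (b + e + of_int k - 1) 1 * hasse i (kern a 0)) (YV u (- k + int i) v) w"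
      by (simp add: linearD(2)[OF L] linearD(2)[OF linear_res_series])
  qed
  finally show ?thesis .
qed

text \<open>
  For \<open>l = -2\<close> the expansions of \<open>(x\<^sub>1 - x\<^sub>2)\<^sup>-\<^sup>2\<close> give \<open>u\<close>, respectively \<open>v\<close>, as outer operator
  a pole of order at least two, respectively three; the third order of the pole compensates the
  exponent \<open>b + 1\<close>.
\<close>

lemma iterate_2_OM:
  assumes u: "a \<in> half_integers" "u \<in> wt a" "u \<in> V p"
    and v: "b \<in> half_integers" "v \<in> wt b" "v \<in> V q"
    and "b' = b \<or> b' = b + 1"
  shows "iterate_sum (-2) (kern a 0) u (kern b' 1) v w \<in> OM"
proof -
  have "res (fls_shift (int j - (-2)) (kern a 0)) u y \<in> OM" for j y
    using res_kern_OM[OF u(1,2), of 0 "2 + int j"] by (simp add: add.commute)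
  moreover have "res (fls_shift (int j - (-2)) (kern b' 1)) v y \<in> OM" for j y
    using assms(7) res_kern_OM[OF v(1,2), of 0 "3 + int j"] res_kern_OM[OF v(1,2), of 1 "3 + int j"]
    by (auto simp: add_ac)
  ultimately show ?thesis
    unfolding Jacobi_series[OF u(3) v(3), symmetric]
    by (intro OM_closed product_sum_OM)
qed

text \<open>
  In the expansion of \<open>(x\<^sub>1 - x\<^sub>2)\<^sup>-\<^sup>1\<close> all terms but the first have a pole of order at least
  two in \<open>x\<^sub>1\<close>.
\<close>

lemma res_product_1:
  assumes u: "a \<in> half_integers" "u \<in> wt a"
  shows "product_sum (-1) (kern a 0) u (kern b' 1) v w
     - res (kern a 1) u (res (kern b' 1) v w) \<in> OM"
proof -
  let ?g = "\<lambda>j. sM (alt_binomial (-1) j)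
     (res (fls_shift (int j - (-1)) (kern a 0)) u (res (fls_shift (- int j) (kern b' 1)) v w))"
  have "Sum_any ?g - ?g 0 \<in> OM"
    using res_kern_OM[OF u, of 0]
    by (intro M.Sum_any_minus_0_mem subspace_OM finite_product_sum) (simp add: alt_binomial_minus_1)
  then show ?thesis by (simp add: product_sum_def alt_binomial_minus_1)
qed

lemma iterate_1_left_OM:
  assumes u: "a \<in> half_integers" "u \<in> wt a" "u \<in> V p"
    and v: "b \<in> half_integers" "v \<in> wt b" "v \<in> V q"
  shows "iterate_sum (-1) (kern a 0) u (kern b 1) v w - res (kern a 1) u (res (kern b 1) v w) \<in> OM"
proof -
  have "res (fls_shift (int j - (-1)) (kern b 1)) v y \<in> OM" for j y
    using res_kern_OM[OF v(1,2), of 0 "2 + int j"] by (simp add: add_ac)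
  then have "sM ((-1) powi (-1) * koszul_sign p q)
      (product_sum (-1) (kern b 1) v (kern a 0) u w) \<in> OM"
    by (intro OM_closed product_sum_OM)
  from OM_closed(3)[OF res_product_1[OF u(1,2), of b v w] this] show ?thesis
    unfolding Jacobi_series[OF u(3) v(3), symmetric] by (simp add: algebra_simps)
qed

text \<open>
  By \<open>kern (b - 1) (k + 1) + kern (b - 1) k = kern b (k + 1)\<close>, lowering the pole order by one
  changes the sign modulo \<open>O(M)\<close>.
\<close>

lemma alternating_kern_OM:
  assumes "b \<in> half_integers" "v \<in> wt b"
  shows "res (kern (b - 1) (2 + int j)) v y + sM ((-1) ^ j) (res (kern (b - 1) 1) v y) \<in> OM"
proof (induction j)
  case (0)
  show ?case using kern_Suc[of "b - 1" 2] res_kern_OM[OF assms, of 0 2 y]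
    by (simp add: linearD(1)[OF linear_res_series])
next
  case (Suc j)
  have "res (kern (b - 1) (2 + int (Suc j))) v y + res (kern (b - 1) (2 + int j)) v y \<in> OM"
    using kern_Suc[of "b - 1" "2 + int (Suc j)"] res_kern_OM[OF assms, of 0 "2 + int (Suc j)" y]
    by (simp add: linearD(1)[OF linear_res_series] flip: linearD(1)[OF linear_res_series])
  from OM_closed(3)[OF this Suc.IH] show ?case by (simp add: algebra_simps)
qed

text \<open>
  Here the second product of residues in the Jacobi identity contributes: modulo \<open>O(M)\<close> it is
  minus the residue of \<open>v\<close> with a simple pole applied to the residue of \<open>u\<close> against
  \<open>(1 + x)\<^sup>a\<^sup>-\<^sup>1\<close>. The first product can be reordered by \<open>commutator_OM\<close>, and
  \<open>(1 + x)\<^sup>a x\<^sup>-\<^sup>1 - (1 + x)\<^sup>a\<^sup>-\<^sup>1 = (1 + x)\<^sup>a\<^sup>-\<^sup>1 x\<^sup>-\<^sup>1\<close>.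
\<close>

lemma iterate_1_right_OM:
  assumes u: "a \<in> half_integers" "u \<in> wt a" "u \<in> V p"
    and v: "b \<in> half_integers" "v \<in> wt b" "v \<in> V q"
  shows "iterate_sum (-1) (kern a 0) u (kern (b - 1) 1) v w
    - sM (koszul_sign p q) (res (kern (b - 1) 1) v (res (kern (a - 1) 1) u w)) \<in> OM"
proof -
  let ?E = "\<lambda>y. res (kern (b - 1) 1) v y"
  define P where "P = product_sum (-1) (kern (b - 1) 1) v (kern a 0) u w"
  have P: "P + ?E (res (kern (a - 1) 0) u w) \<in> OM"
  proof -
    obtain J where J: "\<forall>f. \<forall>j\<ge>J. res f v (res (fls_shift (- int j) (kern a 0)) u w) = 0"
      using product_sum_truncation by blast
    obtain N where N: "\<And>f. below N f \<Longrightarrow> res f u w = 0" using res_below by blast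
    \<comment> \<open>Cut the sum where its terms vanish and where also the remainder of the geometric series
        acts by zero.\<close>
    define K where "K = max J (nat N)"
    have vanish: "res (kern (a - 1) (- int K)) u w = 0"
      by (rule N) (auto simp: kern_nth K_def)
    have "P = (\<Sum>j<K. res (kern (b - 1) (2 + int j)) v (res (kern a (- int j)) u w))"
    proof -
      have "res f v (res (kern a (- int j)) u w) = 0" if "\<not> j < K" for f j
        using J that by (simp add: K_def)
      then have "P = (\<Sum>j<K. sM (alt_binomial (-1) j)
          (res (fls_shift (int j - (-1)) (kern (b - 1) 1)) v (res (fls_shift (- int j) (kern a 0))
              u w)))"
        unfolding P_def product_sum_def by (intro Sum_any.expand_superset) auto
      then show ?thesis by (simp add: alt_binomial_minus_1 add.commute)
    qed
    moreover have "(\<Sum>j<K. res (kern (b - 1) (2 + int j)) v (res (kern a (- int j)) u w)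
        + sM ((-1) ^ j) (?E (res (kern a (- int j)) u w))) \<in> OM"
      by (intro M.subspace_sum subspace_OM alternating_kern_OM v)
    moreover have "(\<Sum>j<K. sM ((-1) ^ j) (?E (res (kern a (- int j)) u w)))
        = ?E (res (kern (a - 1) 0) u w)"
    proof -
      interpret E: Vector_Spaces.linear sM sM "?E" by (rule linear_res_right)
      interpret R: Vector_Spaces.linear fls_scale sM "\<lambda>f. res f u w" by (rule linear_res_series)
      have "(\<Sum>j<K. sM ((-1) ^ j) (res (kern a (- int j)) u w)) = res (kern (a - 1) 0) u w"
        using arg_cong[OF kern_telescope[where a = "a - 1" and J = K], of "\<lambda>f. res f u w"]
        by (simp add: R.sum R.scale R.diff vanish)
      from arg_cong[OF this, of ?E] show ?thesis
        by (simp add: E.sum E.scale)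
    qed
    ultimately show ?thesis by (simp add: sum.distrib)
  qed
  have split: "res (kern a 1) u w = res (kern (a - 1) 1) u w + res (kern (a - 1) 0) u w"
    using kern_Suc[of "a - 1" 1] by (simp add: linearD(1)[OF linear_res_series])
  have comm: "res (kern a 1) u (?E w) - sM (koszul_sign p q) (?E (res (kern a 1) u w)) \<in> OM"
    by (rule commutator_OM[OF u v, where r = 0]) auto
  have "iterate_sum (-1) (kern a 0) u (kern (b - 1) 1) v w - res (kern a 1) u (?E w)
      - sM (koszul_sign p q) P \<in> OM"
    using res_product_1[OF u(1,2), of "b - 1" v w]
    unfolding Jacobi_series[OF u(3) v(3), symmetric] P_def by (simp add: algebra_simps)
  from OM_closed(2)[OF OM_closed(2)[OF this comm] OM_closed(4)[OF P, of "koszul_sign p q"]]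
  show ?thesis
    by (simp add: split linearD(1)[OF linear_res_right] M.scale_right_distrib algebra_simps)
qed

end

context zhu_module
begin

section \<open>The two actions\<close>

abbreviation LA where "LA \<equiv> left_action sV YV \<omega> sM Y"
abbreviation RA where "RA \<equiv> right_action sV V YV \<omega> sM M Y"

lemma zhu_module_adjoint: "zhu_module sV V dV sV V dV YV vac YV \<omega>"
  by (intro zhu_module.intro VA.dg_action_axioms VA.dg_vertex_operator_algebra_axioms)

lemma linear_mem_OM:
  assumes "Vector_Spaces.linear sV sM L"
    and "\<And>a p x. a \<in> half_integers \<Longrightarrow> x \<in> wt a \<Longrightarrow> x \<in> V p \<Longrightarrow> L x \<in> OM"
  shows "L u \<in> OM"
  by (rule bihomogeneous_induct[of "\<lambda>u. L u \<in> OM"]) (simp_all add: linearD[OF assms(1)] OM_closed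
      assms(2))

text \<open>
  The generators of \<open>O(M)\<close> may be taken with \<open>u\<close> homogeneous also in degree.
\<close>

lemma OM_image:
  assumes L: "Vector_Spaces.linear sM s' L" and S: "module.subspace s' S"
    and gen: "\<And>a p u m. a \<in> half_integers \<Longrightarrow> u \<in> wt a \<Longrightarrow> u \<in> V p \<Longrightarrow> L (res (kern a 2) u m) \<in> S"
    and m: "m \<in> OM"
  shows "L m \<in> S"
proof -
  interpret L: Vector_Spaces.linear sM s' L by (rule L)
  have "OM \<subseteq> {m. L m \<in> S}"
    unfolding OM_def O_space_def
  proof (rule M.span_minimal[OF _ linear_subspace_preimage[OF L S]], clarsimp)
    fix a u m assume a: "a \<in> half_integers" and "u \<in> wt a"
    from this(2) show "L (residue_action sM Y a 2 u m) \<in> S"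
      unfolding residue_action_eq_res
    proof (induction rule: weight_induct)
      case (homogeneous p x)
      then show ?case using a gen by blast
    qed (simp_all add: linearD[OF linear_res_left] L.add L.vs2.subspace_0[OF S]
        L.vs2.subspace_add[OF S])
  qed
  with m show ?thesis by blast
qed

lemma linear_residue_action_left: "Vector_Spaces.linear sV sM (\<lambda>u. residue_action sM Y a k u m)"
  unfolding residue_action_eq_res by (rule linear_res_left)

lemma linear_residue_action_right: "Vector_Spaces.linear sM sM (residue_action sM Y a k u)"
  unfolding residue_action_eq_res[abs_def] by (rule linear_res_right)

lemma finite_left_action:
  "finite {a. residue_action sM Y a 1 (component half_integers wt u a) m \<noteq> 0}"
  by (rule finite_subset[OF _ V.finite_component[OF VA.weight_graded, of u]])
    (auto simp: linearD(3)[OF linear_residue_action_left])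

lemma linear_left_action_left: "Vector_Spaces.linear sV sM (\<lambda>u. LA u m)"
  unfolding left_action_def
  by (intro M.linear_Sum_any_pointwise finite_left_action V.vector_space_axioms
      linear_comp[OF V.linear_component[OF VA.weight_graded] linear_residue_action_left])

lemma linear_left_action_right: "Vector_Spaces.linear sM sM (LA u)"
  unfolding left_action_def[abs_def]
  by (intro M.linear_Sum_any_pointwise finite_left_action M.vector_space_axioms
      linear_residue_action_right)

lemma left_action_weight:
  assumes "a \<in> half_integers" "u \<in> wt a"
  shows "LA u m = res (kern a 1) u m"
proof -
  have "LA u m = Sum_any (\<lambda>b. if b = a then residue_action sM Y b 1 u m else 0)"
    unfolding left_action_def
    by (intro Sum_any.cong)
      (simp add: V.component_homogeneous[OF VA.weight_graded assms]
          linearD(3)[OF linear_residue_action_left])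
  then show ?thesis by (simp add: residue_action_eq_res)
qed

definition right_term :: "'m \<Rightarrow> 'v \<Rightarrow> complex \<times> int \<times> int \<Rightarrow> 'm" where
  "right_term m u = (\<lambda>(a, p, q). sM ((-1) powi (p * q))
     (residue_action sM Y (a - 1) 1
       (component UNIV V (component half_integers wt u a) p) (component UNIV M m q)))"

lemma right_action_eq: "RA m u = Sum_any (right_term m u)"
  by (simp add: right_action_def right_term_def)

lemma finite_right_term: "finite {i. right_term m u i \<noteq> 0}"
proof (rule finite_subset)
  let ?A = "{a. component half_integers wt u a \<noteq> 0}"
  let ?P = "\<lambda>a. {p. component UNIV V (component half_integers wt u a) p \<noteq> 0}"
  let ?Q = "{q. component UNIV M m q \<noteq> 0}"
  show "finite (Sigma ?A (\<lambda>a. ?P a \<times> ?Q))"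
    by (intro finite_SigmaI finite_cartesian_product V.finite_component V.graded VA.weight_graded
        M.finite_component M.graded)
  show "{i. right_term m u i \<noteq> 0} \<subseteq> Sigma ?A (\<lambda>a. ?P a \<times> ?Q)"
    by (auto simp: right_term_def linearD(3)[OF linear_residue_action_left]
        linearD(3)[OF linear_residue_action_right] linearD(3)[OF V.linear_component[OF V.graded]])
qed

lemma linear_right_action_right: "Vector_Spaces.linear sV sM (\<lambda>u. RA m u)"
  unfolding right_action_eq
proof (intro M.linear_Sum_any_pointwise finite_right_term V.vector_space_axioms)
  fix i :: "complex \<times> int \<times> int"
  obtain a p q where "i = (a, p, q)" by (cases i)
  then show "Vector_Spaces.linear sV sM (\<lambda>u. right_term m u i)"
    unfolding right_term_def
    by (simp, intro M.linear_scale_fun linear_comp[OF _ linear_residue_action_left]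
        linear_comp[OF V.linear_component[OF VA.weight_graded] V.linear_component[OF V.graded]])
qed

lemma linear_right_action_left: "Vector_Spaces.linear sM sM (\<lambda>m. RA m u)"
  unfolding right_action_eq
proof (intro M.linear_Sum_any_pointwise finite_right_term M.vector_space_axioms)
  fix i :: "complex \<times> int \<times> int"
  obtain a p q where "i = (a, p, q)" by (cases i)
  then show "Vector_Spaces.linear sM sM (\<lambda>m. right_term m u i)"
    unfolding right_term_def
    by (simp, intro M.linear_scale_fun
        linear_comp[OF M.linear_component[OF M.graded] linear_residue_action_right])
qed

text \<open>
  The definition splits \<open>m\<close> into components as well; summing over them reassembles \<open>m\<close> with the
  sign operator applied.
\<close>

lemma right_action_bihomogeneous:
  assumes "a \<in> half_integers" "u \<in> wt a" "u \<in> V p"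
  shows "RA m u = res (kern (a - 1) 1) u (M.parity p m)"
proof -
  have *: "right_term m u (b, r, q) = (if b = a \<and> r = p
      then sM ((-1) powi (p * q)) (res (kern (a - 1) 1) u (component UNIV M m q)) else 0)" for b r q
    by (simp add: right_term_def V.component_homogeneous[OF VA.weight_graded assms(1,2)]
        V.component_homogeneous[OF V.graded UNIV_I assms(3)]
            linearD(3)[OF linear_residue_action_left]
        linearD(3)[OF V.linear_component[OF V.graded]] residue_action_eq_res
            linearD(3)[OF linear_res_left])
  have "RA m u = Sum_any (\<lambda>q. right_term m u (a, p, q))"
    unfolding right_action_eq
  proof (rule Sum_any_inj)
    show "inj (\<lambda>q. (a, p, q))" by (rule injI) simp
    fix i :: "complex \<times> int \<times> int" assume "i \<notin> range (\<lambda>q. (a, p, q))"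
    then show "right_term m u i = 0" by (cases i) (auto simp: *)
  qed
  also have "\<dots> = Sum_any (\<lambda>q. res (kern (a - 1) 1) u
      (sM ((-1) powi (p * q)) (component UNIV M m q)))"
    by (simp add: * linearD(2)[OF linear_res_right])
  also have "\<dots> = res (kern (a - 1) 1) u (M.parity p m)"
    unfolding M.parity_def
    by (rule linear_Sum_any[OF linear_res_right
        M.finite_support_scale[OF M.finite_component[OF M.graded]], symmetric])
  finally show ?thesis .
qed

abbreviation OV where "OV \<equiv> O_space sV YV \<omega> sV YV"
abbreviation zhu where "zhu \<equiv> zhu_product sV YV \<omega>"

lemma zhu_weight: "a \<in> half_integers \<Longrightarrow> u \<in> wt a \<Longrightarrow> zhu u v = residue_action sV YV a 1 u v"
proof -
  interpret VV: zhu_module sV V dV sV V dV YV vac YV \<omega> by (rule zhu_module_adjoint)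
  show "a \<in> half_integers \<Longrightarrow> u \<in> wt a \<Longrightarrow> zhu u v = residue_action sV YV a 1 u v"
    by (simp add: zhu_product_def VV.left_action_weight VA.residue_action_eq_res)
qed

lemma linear_zhu_left: "Vector_Spaces.linear sV sV (\<lambda>u. zhu u v)"
  unfolding zhu_product_def
  by (rule zhu_module.linear_left_action_left[OF zhu_module_adjoint])

lemma linear_zhu_right: "Vector_Spaces.linear sV sV (zhu u)"
  unfolding zhu_product_def
  by (rule zhu_module.linear_left_action_right[OF zhu_module_adjoint])

lemma linear_residue_action_adjoint:
  "Vector_Spaces.linear sV sV (residue_action sV YV a k u)"
  by (rule zhu_module.linear_residue_action_right[OF zhu_module_adjoint])

lemma OV_image:
  assumes L: "Vector_Spaces.linear sV sM L"
    and gen: "\<And>a p u b q v. a \<in> half_integers \<Longrightarrow> u \<in> wt a \<Longrightarrow> u \<in> V p \<Longrightarrow>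
      b \<in> half_integers \<Longrightarrow> v \<in> wt b \<Longrightarrow> v \<in> V q \<Longrightarrow> L (residue_action sV YV a 2 u v) \<in> OM"
    and u: "u \<in> OV"
  shows "L u \<in> OM"
proof -
  interpret VV: zhu_module sV V dV sV V dV YV vac YV \<omega> by (rule zhu_module_adjoint)
  show ?thesis
  proof (rule VV.OM_image[OF L subspace_OM _ u[folded VV.OM_def]])
    fix a p u v assume u: "a \<in> half_integers" "u \<in> wt a" "u \<in> V p"
    show "L (VA.res (kern a 2) u v) \<in> OM"
      unfolding VA.residue_action_eq_res[symmetric]
      by (rule linear_mem_OM[OF linear_comp[OF linear_residue_action_adjoint L]]) (rule gen[OF u])
  qed
qed

text \<open>
  Interchanging the residues of \<open>u\<close> and \<open>v\<close> leaves a generator of \<open>O(M)\<close> and a commutator. The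
  exponents are those of the weights, hence the excess \<open>r = 1\<close>, which the double pole of \<open>v\<close>
  allows.
\<close>

lemma left_action_OM: "m \<in> OM \<Longrightarrow> LA u m \<in> OM"
proof (rule linear_mem_OM[OF linear_left_action_left])
  fix a p u assume m: "m \<in> OM" and u: "a \<in> half_integers" "u \<in> wt a" "u \<in> V p"
  show "LA u m \<in> OM"
  proof (rule OM_image[OF linear_left_action_right subspace_OM _ m])
    fix b q v w assume v: "b \<in> half_integers" "v \<in> wt b" "v \<in> V q"
    have "res (kern a 1) u (res (kern b 2) v w) - sM (koszul_sign p q)
        (res (kern b 2) v (res (kern a 1) u w)) \<in> OM"
      by (rule commutator_OM[OF u v, where r = 1]) auto
    from OM_closed(2)[OF this OM_closed(4)[OF res_kern_OM_2[OF v(1,2), of "res (kern a 1) u w"],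
        of "koszul_sign p q"]]
    show "LA u (res (kern b 2) v w) \<in> OM"
      by (simp add: left_action_weight[OF u(1,2)])
  qed
qed

lemma right_action_OM: "m \<in> OM \<Longrightarrow> RA m u \<in> OM"
proof (rule linear_mem_OM[OF linear_right_action_right])
  fix a p u assume m: "m \<in> OM" and u: "a \<in> half_integers" "u \<in> wt a" "u \<in> V p"
  show "RA m u \<in> OM"
  proof (rule OM_image[OF linear_right_action_left subspace_OM _ m])
    fix b q v w assume v: "b \<in> half_integers" "v \<in> wt b" "v \<in> V q"
    let ?w = "M.parity p w"
    have "res (kern (a - 1) 1) u (res (kern b 2) v ?w)
        - sM (koszul_sign p q) (res (kern b 2) v (res (kern (a - 1) 1) u ?w)) \<in> OM"
      by (rule commutator_OM[OF u v, where r = 0]) auto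
    from OM_closed(2)[OF this OM_closed(4)[OF res_kern_OM_2[OF v(1,2), of "res (kern (a - 1) 1) u
        ?w"], of "koszul_sign p q"]]
    show "RA (res (kern b 2) v w) u \<in> OM"
      by (simp add: right_action_bihomogeneous[OF u] parity_res[OF v(3)]
          linearD(2)[OF linear_res_right] OM_closed)
  qed
qed

lemma left_action_iterate:
  assumes u: "a \<in> half_integers" "u \<in> wt a" "u \<in> V p"
    and v: "b \<in> half_integers" "v \<in> wt b" "v \<in> V q"
  shows "LA (residue_action sV YV a k u v) m = iterate_sum (- k) (kern a 0) u
      (kern (b + of_int k - 1) 1) v m"
  using linear_iterate_residue[OF u v linear_left_action_left[of m], where e = 0 and w = m
      and k = k] by (simp add: left_action_weight)

lemma right_action_iterate:
  assumes u: "a \<in> half_integers" "u \<in> wt a" "u \<in> V p"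
    and v: "b \<in> half_integers" "v \<in> wt b" "v \<in> V q"
  shows "RA m (residue_action sV YV a k u v)
    = iterate_sum (- k) (kern a 0) u (kern (b + of_int k - 2) 1) v (M.parity (p + q) m)"
proof -
  have "RA m (residue_action sV YV a k u v)
    = iterate_sum (- k) (kern a 0) u (kern (b + (- 1) + of_int k - 1) 1) v (M.parity (p + q) m)"
    by (rule linear_iterate_residue[OF u v linear_right_action_right])
      (simp add: right_action_bihomogeneous M.parity_even)
  moreover have "b + (- 1) + of_int k - 1 = b + of_int k - 2" by simp
  ultimately show ?thesis by (simp only:)
qed

lemma left_action_OV: "u \<in> OV \<Longrightarrow> LA u m \<in> OM"
proof (erule OV_image[OF linear_left_action_left, rotated])
  fix a p u b q v
  assume u: "a \<in> half_integers" "u \<in> wt a" "u \<in> V p"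
    and v: "b \<in> half_integers" "v \<in> wt b" "v \<in> V q"
  show "LA (residue_action sV YV a 2 u v) m \<in> OM"
    unfolding left_action_iterate[OF u v] using iterate_2_OM[OF u v, of "b + 1" m]
        by (simp add: add.commute)
qed

lemma right_action_OV: "u \<in> OV \<Longrightarrow> RA m u \<in> OM"
proof (erule OV_image[OF linear_right_action_right, rotated])
  fix a p u b q v
  assume u: "a \<in> half_integers" "u \<in> wt a" "u \<in> V p"
    and v: "b \<in> half_integers" "v \<in> wt b" "v \<in> V q"
  show "RA m (residue_action sV YV a 2 u v) \<in> OM"
    unfolding right_action_iterate[OF u v] using iterate_2_OM[OF u v, of b] by simp
qed

lemma bihomogeneous_mem_OM2:
  assumes lin1: "\<And>v. Vector_Spaces.linear sV sM (\<lambda>u. B u v)" and lin2: "\<And>u. Vector_Spaces.linear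
      sV sM (B u)"
    and "\<And>a p u b q v. a \<in> half_integers \<Longrightarrow> u \<in> wt a \<Longrightarrow> u \<in> V p \<Longrightarrow>
      b \<in> half_integers \<Longrightarrow> v \<in> wt b \<Longrightarrow> v \<in> V q \<Longrightarrow> B u v \<in> OM"
  shows "B u v \<in> OM"
  by (rule linear_mem_OM[OF lin1], rule linear_mem_OM[OF lin2], rule assms(3))

lemma left_action_assoc: "LA (zhu u v) m - LA u (LA v m) \<in> OM"
proof (rule bihomogeneous_mem_OM2[where B = "\<lambda>u v. LA (zhu u v) m - LA u (LA v m)"])
  fix a p u b q v
  assume u: "a \<in> half_integers" "u \<in> wt a" "u \<in> V p"
    and v: "b \<in> half_integers" "v \<in> wt b" "v \<in> V q"
  show "LA (zhu u v) m - LA u (LA v m) \<in> OM"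
    using iterate_1_left_OM[OF u v, of m]
    by (simp add: zhu_weight[OF u(1,2)] left_action_iterate[OF u v] left_action_weight[OF u(1,2)]
        left_action_weight[OF v(1,2)])
qed (intro M.linear_diff_fun linear_comp[OF linear_zhu_left linear_left_action_left]
    linear_left_action_left
    linear_comp[OF linear_zhu_right linear_left_action_left]
        linear_comp[OF linear_left_action_left linear_left_action_right])+

lemma right_action_assoc: "RA m (zhu u v) - RA (RA m u) v \<in> OM"
proof (rule bihomogeneous_mem_OM2[where B = "\<lambda>u v. RA m (zhu u v) - RA (RA m u) v"])
  fix a p u b q v
  assume u: "a \<in> half_integers" "u \<in> wt a" "u \<in> V p"
    and v: "b \<in> half_integers" "v \<in> wt b" "v \<in> V q"
  show "RA m (zhu u v) - RA (RA m u) v \<in> OM"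
    using iterate_1_right_OM[OF u v, of "M.parity (p + q) m"]
    by (simp add: zhu_weight[OF u(1,2)] right_action_iterate[OF u v]
        right_action_bihomogeneous[OF u]
        right_action_bihomogeneous[OF v] parity_res[OF u(3)] M.parity_parity
            linearD(2)[OF linear_res_right] add.commute)
qed (intro M.linear_diff_fun linear_comp[OF linear_zhu_left linear_right_action_right]
    linear_right_action_right
    linear_comp[OF linear_zhu_right linear_right_action_right]
        linear_comp[OF linear_right_action_right linear_right_action_left])+

text \<open>
  The sign of the right action by \<open>v\<close> sees the degree of \<open>u\<close> on one side only, and this is the
  Koszul sign of the commutator.
\<close>

lemma left_right_action_commute: "RA (LA u m) v - LA u (RA m v) \<in> OM"
proof (rule bihomogeneous_mem_OM2[where B = "\<lambda>u v. RA (LA u m) v - LA u (RA m v)"])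
  fix a p u b q v
  assume u: "a \<in> half_integers" "u \<in> wt a" "u \<in> V p"
    and v: "b \<in> half_integers" "v \<in> wt b" "v \<in> V q"
  let ?w = "M.parity q m"
  have "res (kern a 1) u (res (kern (b - 1) 1) v ?w) - sM (koszul_sign p q)
      (res (kern (b - 1) 1) v (res (kern a 1) u ?w)) \<in> OM"
    by (rule commutator_OM[OF u v, where r = 0]) auto
  from M.subspace_neg[OF subspace_OM this] show "RA (LA u m) v - LA u (RA m v) \<in> OM"
    by (simp add: left_action_weight[OF u(1,2)] right_action_bihomogeneous[OF v]
        parity_res[OF u(3)] linearD(2)[OF linear_res_right])
qed (intro M.linear_diff_fun linear_right_action_right linear_left_action_left
    linear_comp[OF linear_left_action_left linear_right_action_left]
        linear_comp[OF linear_right_action_right linear_left_action_right])+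

lemma vac_weight: "vac \<in> wt 0"
  by (simp add: weight_space_def VA.creation)

lemma zero_half_integer: "0 \<in> half_integers"
  using half_integers_of_int[of 0] by simp

lemma res_vac: "res f vac w = sM (f $$ (-1)) w"
proof -
  have "res f vac w = Sum_any (\<lambda>n. if n = -1 then sM (f $$ n) w else 0)"
    unfolding res_def by (intro Sum_any.cong) (simp add: vacuum)
  then show ?thesis by simp
qed

lemma left_action_vac: "LA vac m = m"
  by (simp add: left_action_weight[OF zero_half_integer vac_weight] res_vac kern_nth)

lemma right_action_vac: "RA m vac = m"
  by (simp add: right_action_bihomogeneous[OF zero_half_integer vac_weight VA.vac_degree] res_vac
      kern_nth M.parity_0)

lemma zhu_vac_right: "zhu u vac = u"
proof (rule bihomogeneous_induct[of "\<lambda>u. zhu u vac = u"])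
  fix a p u assume u: "a \<in> half_integers" "u \<in> wt a"
  have "zhu u vac = Sum_any (\<lambda>n::int. if n = -1 then u else 0)"
    unfolding zhu_weight[OF u] VA.residue_action_eq_res VA.res_def
  proof (rule Sum_any.cong)
    fix n :: int
    show "sV (kern a 1 $$ n) (YV u n vac) = (if n = -1 then u else 0)"
      using VA.creation[of n u] VA.creation_constant[of u] by (cases "n < -1"; cases "n = -1")
          (auto simp: kern_nth)
  qed
  then show "zhu u vac = u" by simp
qed (simp_all add: linearD[OF linear_zhu_left])

end

section \<open>Operations on cosets\<close>

lemma induced2_eqI:
  assumes "x \<in> X" "y \<in> Y" "\<And>x' y'. x' \<in> X \<Longrightarrow> y' \<in> Y \<Longrightarrow> f x' y' +o U = Z"
  shows "induced2 U f X Y = Z"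
  unfolding induced2_def using assms(1,2) by (force simp: assms(3))

context complex_vector_space
begin

lemma coset_eq_iff:
  assumes "subspace U"
  shows "x +o U = y +o U \<longleftrightarrow> x - y \<in> U"
proof
  assume "x +o U = y +o U"
  then have "x + 0 \<in> y +o U" using subspace_0[OF assms] by blast
  then show "x - y \<in> U" by (auto simp: elt_set_plus_def)
next
  have *: "x +o U \<subseteq> y +o U" if "x - y \<in> U" for x y
  proof
    fix z assume "z \<in> x +o U"
    then obtain u where u: "u \<in> U" "z = x + u" by (auto simp: elt_set_plus_def)
    have "y + ((x - y) + u) \<in> y +o U"
      by (rule set_plus_intro2) (rule subspace_add[OF assms that u(1)])
    with u(2) show "z \<in> y +o U" by simp
  qed
  assume "x - y \<in> U"
  moreover from subspace_neg[OF assms this] have "y - x \<in> U" by simp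
  ultimately show "x +o U = y +o U" by (intro equalityI *)
qed

lemmas coset_eqI = coset_eq_iff[THEN iffD2]

lemma induced1_coset:
  assumes f: "Vector_Spaces.linear s' s f" and U: "subspace U" and "module.subspace s' W" "\<And>x. x
      \<in> W \<Longrightarrow> f x \<in> U"
  shows "induced1 U f (x +o W) = f x +o U"
proof -
  interpret f: Vector_Spaces.linear s' s f by (rule f)
  have "f x' +o U = f x +o U" if x': "x' \<in> x +o W" for x'
  proof -
    obtain w where "w \<in> W" "x' = x + w" using x' by (auto simp: elt_set_plus_def)
    then show ?thesis using assms(4) by (simp add: coset_eq_iff[OF U] f.add)
  qed
  moreover have "x \<in> x +o W"
    using f.vs1.subspace_0[OF assms(3)] set_plus_intro2[of 0 W x] by simp
  ultimately show ?thesis unfolding induced1_def by blast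
qed

lemma induced2_add:
  assumes U: "subspace U"
  shows "induced2 U (+) (x +o U) (y +o U) = (x + y) +o U"
proof -
  have "(x' + y') +o U = (x + y) +o U" if xy: "x' \<in> x +o U" "y' \<in> y +o U" for x' y'
  proof -
    obtain a b where "a \<in> U" "b \<in> U" and *: "x' = x + a" "y' = y + b"
      using xy by (auto simp: elt_set_plus_def)
    then have "a + b \<in> U" by (intro subspace_add[OF U])
    moreover have "(x' + y') - (x + y) = a + b" by (simp add: *)
    ultimately show ?thesis by (simp only: coset_eq_iff[OF U])
  qed
  moreover have "x \<in> x +o U" for x
    using subspace_0[OF U] set_plus_intro2[of 0 U x] by simp
  ultimately show ?thesis by (intro induced2_eqI[of x _ y])
qed

text \<open>
  The operation is well defined since \<open>f (x + a) (y + b) - f x y = f x b + f a (y + b)\<close> with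
  both terms in \<open>U\<close>.
\<close>

lemma induced2_coset:
  fixes f :: "'a::ab_group_add \<Rightarrow> 'b::ab_group_add \<Rightarrow> 'v"
  assumes lin: "\<And>y. Vector_Spaces.linear s1 s (\<lambda>x. f x y)" "\<And>x. Vector_Spaces.linear s2 s (f x)"
    and sub: "subspace U" "module.subspace s1 U1" "module.subspace s2 U2"
    and mem: "\<And>x y. x \<in> U1 \<Longrightarrow> f x y \<in> U" "\<And>x y. y \<in> U2 \<Longrightarrow> f x y \<in> U"
  shows "induced2 U f (x +o U1) (y +o U2) = f x y +o U"
proof -
  interpret f1: Vector_Spaces.linear s1 s "\<lambda>x. f x y'" for y' by (rule lin(1))
  interpret f2: Vector_Spaces.linear s2 s "f x'" for x' by (rule lin(2))
  have eq: "f x' y' +o U = f x y +o U" if x': "x' \<in> x +o U1" and y': "y' \<in> y +o U2" for x' y'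
  proof -
    obtain a b where ab: "a \<in> U1" "b \<in> U2" and *: "x' = x + a" "y' = y + b"
      using x' y' by (auto simp: elt_set_plus_def)
    have "f x' y' - f x y = f x b + f a (y + b)"
      unfolding * f1.add f2.add by (simp add: algebra_simps)
    moreover have "f x b + f a (y + b) \<in> U" by (intro subspace_add[OF sub(1)] mem ab)
    ultimately show ?thesis by (simp only: coset_eq_iff[OF sub(1)])
  qed
  have "x \<in> x +o U1" "y \<in> y +o U2"
    using f1.vs1.subspace_0[OF sub(2)] set_plus_intro2[of 0 U1 x]
      f2.vs1.subspace_0[OF sub(3)] set_plus_intro2[of 0 U2 y] by simp_all
  then show ?thesis by (rule induced2_eqI) (rule eq)
qed

lemma quotient_module:
  fixes R :: "(complex, 'v set) module"
  assumes U: "subspace U" and R: "carrier R = range (\<lambda>x. x +o U)" "zero R = U"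
    "add R = induced2 U (+)" "Module.smult R = (\<lambda>c. induced1 U (s c))"
  shows "Module.module complex_ring R"
proof -
  have smult: "induced1 U (s c) (x +o U) = s c x +o U" for c x
    by (rule induced1_coset[OF linear_scale_self U U subspace_scale[OF U]])
  have mem: "x +o U \<in> carrier R" for x by (simp add: R)
  note simps = R smult induced2_add[OF U] complex_ring_def
  show ?thesis
  proof (rule moduleI)
    show "cring complex_ring"
    proof (rule cringI)
      show "abelian_group complex_ring"
      proof (rule abelian_groupI)
        fix x show "\<exists>y\<in>carrier complex_ring. y \<oplus>\<^bsub>complex_ring\<^esub> x = \<zero>\<^bsub>complex_ring\<^esub>"
          by (rule bexI[of _ "- x"]) (simp_all add: complex_ring_def)
      qed (simp_all add: complex_ring_def add.assoc add.commute)
      show "Group.comm_monoid complex_ring"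
        by (rule comm_monoidI) (simp_all add: complex_ring_def mult.assoc mult.commute)
    qed (simp add: complex_ring_def distrib_right)
    show "abelian_group R"
    proof (rule abelian_groupI)
      show "\<zero>\<^bsub>R\<^esub> \<in> carrier R" using mem[of 0] R by simp
      fix x assume "x \<in> carrier R"
      then obtain v where v: "x = v +o U" using R by auto
      have "add R (0 +o U) (v +o U) = v +o U" by (simp only: simps add_0_left)
      then show "\<zero>\<^bsub>R\<^esub> \<oplus>\<^bsub>R\<^esub> x = x" by (simp add: v R(2))
      have "add R ((- v) +o U) (v +o U) = 0 +o U" by (simp only: simps left_minus)
      then show "\<exists>y\<in>carrier R. y \<oplus>\<^bsub>R\<^esub> x = \<zero>\<^bsub>R\<^esub>" using mem[of "- v"] by (auto simp: v R(2))
    qed (auto simp: simps add_ac)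
  qed (auto simp: simps scale_right_distrib scale_left_distrib)
qed

end

context zhu_module
begin

section \<open>The bimodule A(M)\<close>

abbreviation A where "A \<equiv> zhu_algebra sV YV vac \<omega>"
abbreviation AM where "AM \<equiv> zhu_bimodule sV YV \<omega> sM Y"

lemma subspace_OV: "V.subspace OV"
  by (simp add: O_space_def)

lemma OV_OM: "zhu_module.OM sV sV YV YV \<omega> = OV"
  by (rule zhu_module.OM_def[OF zhu_module_adjoint])

lemma zhu_coset: "induced2 OV zhu (u +o OV) (v +o OV) = zhu u v +o OV"
  by (rule V.induced2_coset[OF linear_zhu_left linear_zhu_right subspace_OV subspace_OV
      subspace_OV])
    (simp_all add: zhu_product_def zhu_module.left_action_OM[OF zhu_module_adjoint, unfolded OV_OM]
      zhu_module.left_action_OV[OF zhu_module_adjoint, unfolded OV_OM])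

lemma zhu_algebra_simps:
  "carrier A = range (\<lambda>v. v +o OV)" "one A = vac +o OV" "zero A = OV" "add A = induced2 OV (+)"
  "Module.smult A = (\<lambda>c. induced1 OV (sV c))" "Group.monoid.mult A = induced2 OV zhu"
  by (simp_all add: zhu_algebra_def Let_def)

lemma zhu_bimodule_simps:
  "carrier AM = range (\<lambda>m. m +o OM)" "zero AM = OM" "add AM = induced2 OM (+)"
  "Module.smult AM = (\<lambda>c. induced1 OM (sM c))"
  by (simp_all add: zhu_bimodule_def Let_def OM_def)

lemma smult_OV_coset: "induced1 OV (sV c) (u +o OV) = sV c u +o OV"
  by (rule V.induced1_coset[OF V.linear_scale_self subspace_OV subspace_OV
      V.subspace_scale[OF subspace_OV]])

lemma smult_OM_coset: "induced1 OM (sM c) (m +o OM) = sM c m +o OM"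
  by (rule M.induced1_coset[OF M.linear_scale_self subspace_OM subspace_OM
      M.subspace_scale[OF subspace_OM]])

lemmas coset_simps = smult_OV_coset smult_OM_coset V.induced2_add[OF subspace_OV]
  M.induced2_add[OF subspace_OM] zhu_coset

lemma zhu_assoc: "zhu (zhu u v) x - zhu u (zhu v x) \<in> OV"
  using zhu_module.left_action_assoc[OF zhu_module_adjoint, of u v x]
      by (simp add: OV_OM zhu_product_def)

lemma zhu_vac_left: "zhu vac u = u"
  using zhu_module.left_action_vac[OF zhu_module_adjoint] by (simp add: zhu_product_def)

lemma complex_algebra_zhu_algebra: "complex_algebra A"
proof (rule complex_algebra.intro)
  show module: "Module.module complex_ring A"
    by (rule V.quotient_module[OF subspace_OV]) (simp_all add: zhu_algebra_simps)
  show "ring A"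
  proof (rule ringI)
    show "abelian_group A" using module by (rule module.axioms)
    show "monoid A"
      by (rule monoidI)
        (auto simp: zhu_algebra_simps coset_simps V.coset_eqI[OF subspace_OV zhu_assoc]
            zhu_vac_left zhu_vac_right)
  qed (auto simp: zhu_algebra_simps coset_simps linearD[OF linear_zhu_left]
      linearD[OF linear_zhu_right])
  show "complex_algebra_axioms A"
    by unfold_locales
      (auto simp: zhu_algebra_simps coset_simps linearD[OF linear_zhu_left]
          linearD[OF linear_zhu_right])
qed

lemma zhu_left_coset: "zhu_left sV YV \<omega> sM Y (u +o OV) (m +o OM) = LA u m +o OM"
  unfolding zhu_left_def OM_def[symmetric]
  by (rule M.induced2_coset[OF linear_left_action_left linear_left_action_right subspace_OM
      subspace_OV subspace_OM
        left_action_OV left_action_OM])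

lemma zhu_right_coset: "zhu_right sV V YV \<omega> sM M Y (m +o OM) (u +o OV) = RA m u +o OM"
  unfolding zhu_right_def OM_def[symmetric]
  by (rule M.induced2_coset[OF linear_right_action_left linear_right_action_right subspace_OM
      subspace_OM subspace_OV
        right_action_OM right_action_OV])

theorem algebra_bimodule_zhu:
  "algebra_bimodule A AM (zhu_left sV YV \<omega> sM Y) (zhu_right sV V YV \<omega> sM M Y)"
proof (rule algebra_bimodule.intro)
  show "complex_algebra A" by (rule complex_algebra_zhu_algebra)
  show "Module.module complex_ring AM"
    by (rule M.quotient_module[OF subspace_OM]) (simp_all add: zhu_bimodule_simps)
  show "algebra_bimodule_axioms A AM (zhu_left sV YV \<omega> sM Y) (zhu_right sV V YV \<omega> sM M Y)"
    by (rule algebra_bimodule_axioms.intro)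
      (auto simp: zhu_algebra_simps zhu_bimodule_simps coset_simps zhu_left_coset zhu_right_coset
        linearD[OF linear_left_action_left] linearD[OF linear_left_action_right]
        linearD[OF linear_right_action_left] linearD[OF linear_right_action_right]
        M.coset_eqI[OF subspace_OM left_action_assoc] M.coset_eqI[OF subspace_OM right_action_assoc]
        M.coset_eqI[OF subspace_OM left_right_action_commute] left_action_vac right_action_vac)
qed

end

theorem theorem7p4:
  fixes sV :: "complex \<Rightarrow> 'v::ab_group_add \<Rightarrow> 'v" and V :: "int \<Rightarrow> 'v set" and dV :: "'v \<Rightarrow> 'v"
    and YV :: "'v \<Rightarrow> int \<Rightarrow> 'v \<Rightarrow> 'v" and vac \<omega> :: 'v
    and sM :: "complex \<Rightarrow> 'm::ab_group_add \<Rightarrow> 'm" and M :: "int \<Rightarrow> 'm set" and dM :: "'m \<Rightarrow> 'm"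
    and YM :: "'v \<Rightarrow> int \<Rightarrow> 'm \<Rightarrow> 'm"
  assumes "dg_vertex_operator_algebra sV V dV YV vac \<omega>"
    and "weak_dg_module sV V dV YV vac sM M dM YM"
  shows "algebra_bimodule (zhu_algebra sV YV vac \<omega>) (zhu_bimodule sV YV \<omega> sM YM)
    (zhu_left sV YV \<omega> sM YM) (zhu_right sV V YV \<omega> sM M YM)"
proof -
  have "zhu_module sV V dV sM M dM YV vac YM \<omega>"
    by (rule zhu_module.intro[OF weak_dg_module.axioms(2)[OF assms(2)] assms(1)])
  then show ?thesis by (rule zhu_module.algebra_bimodule_zhu)
qed

end
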